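(* For any positive integers $m\geq n$, the tableaux algebra $\mathcal{T}_{n,m}$ is an integral domain. Moreover, as a ring, $\mathcal{T}_{n,m}$ is also Noetherian, reduced, and Jacobson.
   Context: Let $\mathbb{K}$ be an algebraically closed field of characteristic zero. A semistandard Young tableau of partition shape $\lambda$ is a filling of the Ferrers diagram of $\lambda$ (English notation) with positive integers, strictly increasing down columns and weakly increasing from left to right along rows. For positive integers $m\ge n$, $\mathrm{SSYT}_m^n$ denotes the set of all semistandard Young tableaux of all partition shapes with at most $n$ rows and with entries in $\{1,\dots,m\}$ (including the empty tableau $\emptyset$). For $T$ of shape $\lambda$ and $T'$ of shape $\mu$, $T\star T'$ is the semistandard Young tableau of shape $\lambda+\mu$ obtained by horizontally concatenating the rows of $T$ and $T'$ and sorting the entries in each row in weakly increasing order. $(\mathrm{SSYT}_m^n,\star,\emptyset)$ is a commutative monoid, and the tableaux algebra $\mathcal{T}_{n,m}$ is its monoid algebra over $\mathbb{K}$. A commutative ring is Jacobson if every prime ideal is an intersection of maximal ideals. *)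

theory Defs
  imports "HOL-Algebra.Algebra" "HOL-Algebra.Algebraic_Closure" "HOL-Algebra.Ring_Divisibility"
    "HOL-Algebra.Module"
begin

section \<open>Semistandard Young tableaux\<close>

text \<open>
  A partition is the list of its nonzero parts. A filling of a Ferrers diagram (English notation)
  is the list of its rows, from top to bottom, each read from left to right; the empty tableau is
  the empty list. Rows and columns are indexed from 0.
\<close>

definition is_partition :: "nat list \<Rightarrow> bool" where
  "is_partition l \<longleftrightarrow> sorted_wrt (\<ge>) l \<and> (\<forall>p \<in> set l. 0 < p)"

type_synonym tableau = "nat list list"

definition shape :: "tableau \<Rightarrow> nat list" where
  "shape T = map length T"

definition semistandard :: "tableau \<Rightarrow> bool" where
  "semistandard T \<longleftrightarrow>
     is_partition (shape T) \<and>
     (\<forall>r \<in> set T. \<forall>x \<in> set r. 0 < x) \<and>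
     (\<forall>r \<in> set T. sorted r) \<and>
     (\<forall>i j. Suc i < length T \<and> j < length (T ! Suc i) \<longrightarrow> T ! i ! j < T ! Suc i ! j)"

definition SSYT :: "nat \<Rightarrow> nat \<Rightarrow> tableau set" where
  "SSYT n m = {T. semistandard T \<and> length T \<le> n \<and> (\<forall>r \<in> set T. set r \<subseteq> {1..m})}"

text \<open>Rows below the last nonempty one are empty.\<close>

definition tab_row :: "tableau \<Rightarrow> nat \<Rightarrow> nat list" where
  "tab_row T i = (if i < length T then T ! i else [])"

definition tab_star :: "tableau \<Rightarrow> tableau \<Rightarrow> tableau" where
  "tab_star T T' =
     map (\<lambda>i. sort (tab_row T i @ tab_row T' i)) [0..<max (length T) (length T')]"

definition tableaux_monoid :: "nat \<Rightarrow> nat \<Rightarrow> tableau monoid" where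
  "tableaux_monoid n m = \<lparr>carrier = SSYT n m, monoid.mult = tab_star, one = []\<rparr>"

section \<open>Monoid algebras\<close>

definition msupp :: "('k, 'x) ring_scheme \<Rightarrow> ('m \<Rightarrow> 'k) \<Rightarrow> 'm set" where
  "msupp K f = {a. f a \<noteq> \<zero>\<^bsub>K\<^esub>}"

text \<open>
  A formal linear combination of elements of M is represented by its coefficient function f, which
  has finite support and is zero outside the carrier of M. The product is convolution.
\<close>

definition monoid_algebra ::
    "('k, 'x) ring_scheme \<Rightarrow> ('m, 'y) monoid_scheme \<Rightarrow> ('k, 'm \<Rightarrow> 'k) module" where
  "monoid_algebra K M =
     \<lparr>carrier = {f. range f \<subseteq> carrier K \<and> finite (msupp K f) \<and> msupp K f \<subseteq> carrier M},
      monoid.mult = (\<lambda>f g x. \<Oplus>\<^bsub>K\<^esub>p \<in> {(a, b). a \<in> msupp K f \<and> b \<in> msupp K g \<and> a \<otimes>\<^bsub>M\<^esub> b = x}.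
                f (fst p) \<otimes>\<^bsub>K\<^esub> g (snd p)),
      one = (\<lambda>x. if x = \<one>\<^bsub>M\<^esub> then \<one>\<^bsub>K\<^esub> else \<zero>\<^bsub>K\<^esub>),
      ring.zero = (\<lambda>x. \<zero>\<^bsub>K\<^esub>),
      ring.add = (\<lambda>f g x. f x \<oplus>\<^bsub>K\<^esub> g x),
      module.smult = (\<lambda>c f x. c \<otimes>\<^bsub>K\<^esub> f x)\<rparr>"

definition tableaux_algebra ::
    "('k, 'x) ring_scheme \<Rightarrow> nat \<Rightarrow> nat \<Rightarrow> ('k, tableau \<Rightarrow> 'k) module" where
  "tableaux_algebra K n m = monoid_algebra K (tableaux_monoid n m)"

section \<open>Ring-theoretic notions\<close>

definition char_zero :: "('k, 'x) ring_scheme \<Rightarrow> bool" where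
  "char_zero K \<longleftrightarrow> (\<forall>k :: nat. 0 < k \<longrightarrow> [k] \<cdot>\<^bsub>K\<^esub> \<one>\<^bsub>K\<^esub> \<noteq> \<zero>\<^bsub>K\<^esub>)"

definition reduced_ring :: "('a, 'x) ring_scheme \<Rightarrow> bool" where
  "reduced_ring R \<longleftrightarrow>
     ring R \<and> (\<forall>x \<in> carrier R. \<forall>k :: nat. x [^]\<^bsub>R\<^esub> k = \<zero>\<^bsub>R\<^esub> \<longrightarrow> x = \<zero>\<^bsub>R\<^esub>)"

definition jacobson_ring :: "('a, 'x) ring_scheme \<Rightarrow> bool" where
  "jacobson_ring R \<longleftrightarrow>
     cring R \<and>
     (\<forall>P. primeideal P R \<longrightarrow>
        (\<exists>S. S \<noteq> {} \<and> (\<forall>I \<in> S. maximalideal I R) \<and> P = \<Inter> S))"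

end

theory Submission
  imports Defs
begin

text \<open>
  Record a tableau by the multisets of entries of its rows. The rows are sorted, so this
  determines the tableau, and the product of tableaux becomes addition of multisets. A family of multisets comes
  from a semistandard tableau iff, for every $y$, row $i+1$ has at most as many entries
  $\le y$ as row $i$ has entries $< y$. These are linear inequalities in the numbers of
  occurrences (the Gelfand-Tsetlin inequalities), so the monoid of tableaux is the set of lattice
  points of a rational cone. The coordinates used here are the numbers of occurrences together
  with the slacks of the inequalities: they are additive, they determine the tableau
  (\<open>content_inject\<close>), and $S$ divides $T$ as soon as every coordinate of $S$ is at most
  that of $T$, since then the difference again satisfies the inequalities
  (\<open>tableaux_saturated\<close>). The rest of the argument uses only these three properties.
  
  The lexicographic order of the coordinate vectors is a well-order compatible with the product.
  Leading terms multiply, so the monoid algebra is a domain, hence reduced. By Dickson's lemma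
  finitely many leading monomials of an ideal divide all the others; reducing by the
  corresponding elements terminates because the order is well-founded, so every ideal is finitely
  generated (\<open>monoid_algebra_noetherian\<close>). Dickson's lemma, applied to the non-unit
  elements of the monoid, also shows that the monoid is finitely generated, so the algebra is a
  finitely generated $K$-algebra.
  
  That such an algebra is Jacobson is Hilbert's Nullstellensatz. For a prime $P$ and
  $b \notin P$ one needs a maximal ideal containing $P$ but not $b$, and the kernel of a
  $K$-homomorphism from the quotient by $P$ to $K$ that does not kill $b$ is one. Such a
  homomorphism is built one generator at a time (\<open>extend_hom_to_simple_extension\<close>): for a
  domain with a subring $A$ and $0 \ne b \in A[x]$ there is $0 \ne a \in A$ such that
  every homomorphism from $A$ to $K$ that does not kill $a$ extends to $A[x]$ without killing
  $b$. If $x$ is transcendental, $x$ can be sent to any non-root of a polynomial; if $x$ is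
  algebraic, $x$ has to be sent to a root of the image of its minimal relation, and pseudo-division
  by that relation shows that this is well defined.
\<close>

section \<open>Pseudo-division of coefficient lists\<close>

lemma (in cring) eval_map2_diff:
  assumes "length us = length vs" "set us \<subseteq> carrier R" "set vs \<subseteq> carrier R"
    and "a \<in> carrier R" "c \<in> carrier R" "x \<in> carrier R"
  shows "eval (map2 (\<lambda>u v. a \<otimes> u \<ominus> c \<otimes> v) us vs) x = a \<otimes> eval us x \<ominus> c \<otimes> eval vs x"
  using assms
proof (induction us vs rule: list_induct2)
  case Nil
  then show ?case by (simp add: minus_eq)
next
  case (Cons u us v vs)
  define w where "w = x [^] length us"
  have *: "w \<in> carrier R" "eval us x \<in> carrier R" "eval vs x \<in> carrier R" "u \<in> carrier R" "v \<in> carrier R"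
    using Cons.prems Cons.hyps by (auto intro: eval_in_carrier simp: w_def)
  have "eval (map2 (\<lambda>u v. a \<otimes> u \<ominus> c \<otimes> v) (u # us) (v # vs)) x
      = (a \<otimes> u \<ominus> c \<otimes> v) \<otimes> w \<oplus> (a \<otimes> eval us x \<ominus> c \<otimes> eval vs x)"
    using Cons by (simp add: w_def)
  also have "\<dots> = a \<otimes> (u \<otimes> w \<oplus> eval us x) \<ominus> c \<otimes> (v \<otimes> w \<oplus> eval vs x)"
    using * Cons.prems by algebra
  finally show ?case using Cons.hyps by (simp add: w_def)
qed

text \<open>
  One step of the division of $c\,X^k + us$ by $a X^d + hs$, where polynomials are coefficient
  lists with the leading coefficient first: the tail of
  $a \cdot (c X^k + us) - c X^{k-d} \cdot (a X^d + hs)$, whose head is zero. Multiplying by $a$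
  avoids dividing in the coefficient ring. Leading zeros are kept, so that the length of
  the result does not depend on the coefficients.
\<close>
definition pseudo_step :: "('a, 'b) ring_scheme \<Rightarrow> 'a \<Rightarrow> 'a list \<Rightarrow> 'a \<Rightarrow> 'a list \<Rightarrow> 'a list" where
  "pseudo_step R a hs c us =
     map2 (\<lambda>u v. a \<otimes>\<^bsub>R\<^esub> u \<ominus>\<^bsub>R\<^esub> c \<otimes>\<^bsub>R\<^esub> v) us
       (hs @ replicate (length us - length hs) \<zero>\<^bsub>R\<^esub>)"

lemma length_pseudo_step:
  "length hs \<le> length us \<Longrightarrow> length (pseudo_step R a hs c us) = length us"
  by (simp add: pseudo_step_def)

lemma (in cring) eval_pseudo_step:
  assumes "length hs \<le> length us" "set us \<subseteq> carrier R" "set hs \<subseteq> carrier R"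
    and "a \<in> carrier R" "c \<in> carrier R" "x \<in> carrier R"
  shows "a \<otimes> eval (c # us) x
    = c \<otimes> x [^] (length us - length hs) \<otimes> eval (a # hs) x \<oplus> eval (pseudo_step R a hs c us) x"
proof -
  define k where "k = length us - length hs"
  define w where "w = x [^] k"
  define Y where "Y = x [^] length hs"
  have len: "length us = k + length hs" using assms(1) by (simp add: k_def)
  have XY: "x [^] length us = w \<otimes> Y" 
    using assms by (simp add: len w_def Y_def nat_pow_mult)
  have c: "w \<in> carrier R" "Y \<in> carrier R" "eval us x \<in> carrier R" "eval hs x \<in> carrier R"
    using assms by (auto intro: eval_in_carrier simp: w_def Y_def)
  have z: "eval (replicate k \<zero>) x = \<zero>"
    using eval_replicate[of "[]" x k] assms by simp
  have "eval (pseudo_step R a hs c us) x = a \<otimes> eval us x \<ominus> c \<otimes> eval (hs @ replicate k \<zero>) x"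
    unfolding pseudo_step_def k_def[symmetric]
    by (rule eval_map2_diff) (use assms len in auto)
  also have "eval (hs @ replicate k \<zero>) x = eval hs x \<otimes> w"
    using assms c z by (subst eval_append) (auto simp: w_def)
  finally have "eval (pseudo_step R a hs c us) x = a \<otimes> eval us x \<ominus> c \<otimes> (eval hs x \<otimes> w)" .
  moreover have "a \<otimes> (c \<otimes> (w \<otimes> Y) \<oplus> eval us x) =
     c \<otimes> w \<otimes> (a \<otimes> Y \<oplus> eval hs x) \<oplus> (a \<otimes> eval us x \<ominus> c \<otimes> (eval hs x \<otimes> w))"
    using c assms by algebra
  ultimately show ?thesis
    by (simp add: XY Y_def[symmetric] k_def[symmetric] w_def[symmetric])
qed

lemma (in cring) pseudo_step_closed:
  assumes "set us \<subseteq> carrier R" "set hs \<subseteq> carrier R" "a \<in> carrier R" "c \<in> carrier R"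
  shows "set (pseudo_step R a hs c us) \<subseteq> carrier R"
proof
  fix y assume "y \<in> set (pseudo_step R a hs c us)"
  then obtain u v where "(u, v) \<in> set (zip us (hs @ replicate (length us - length hs) \<zero>))"
    and y: "y = a \<otimes> u \<ominus> c \<otimes> v"
    by (auto simp: pseudo_step_def)
  then have "u \<in> set us" "v \<in> set (hs @ replicate (length us - length hs) \<zero>)"
    by (auto dest: set_zip_leftD set_zip_rightD)
  then have "u \<in> carrier R" "v \<in> carrier R" using assms by (auto split: if_splits)
  then show "y \<in> carrier R" using assms y by simp
qed

lemma (in ring_hom_cring) map_pseudo_step:
  assumes "set us \<subseteq> carrier R" "set hs \<subseteq> carrier R" "a \<in> carrier R" "c \<in> carrier R"
  shows "map h (pseudo_step R a hs c us) = pseudo_step S (h a) (map h hs) (h c) (map h us)"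
proof -
  have "map h (map2 (\<lambda>u v. a \<otimes> u \<ominus> c \<otimes> v) us vs)
      = map2 (\<lambda>u v. h a \<otimes>\<^bsub>S\<^esub> u \<ominus>\<^bsub>S\<^esub> h c \<otimes>\<^bsub>S\<^esub> v) (map h us) (map h vs)"
    if "set vs \<subseteq> carrier R" for vs
    using assms that
    by (induction us arbitrary: vs) (auto simp: zip_Cons1 R.minus_eq S.minus_eq split: list.splits)
  from this[of "hs @ replicate (length us - length hs) \<zero>"] show ?thesis
    using assms by (simp add: pseudo_step_def subset_iff)
qed

text \<open>
  Evaluation at $s$ after the coefficients have been mapped by $h$. Carrying the homomorphism along
  lets one division be read off at two points of two different rings.
\<close>
definition hom_eval :: "('b, 'y) ring_scheme \<Rightarrow> ('a \<Rightarrow> 'b) \<Rightarrow> 'b \<Rightarrow> 'a list \<Rightarrow> 'b" where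
  "hom_eval S h s p = ring.eval S (map h p) s"

lemma (in ring_hom_cring) hom_eval_closed:
  "set p \<subseteq> carrier R \<Longrightarrow> s \<in> carrier S \<Longrightarrow> hom_eval S h s p \<in> carrier S"
  unfolding hom_eval_def by (rule S.eval_in_carrier) auto

lemma (in ring_hom_cring) hom_eval_pseudo_step:
  assumes "length hs \<le> length us" "set us \<subseteq> carrier R" "set hs \<subseteq> carrier R"
    and "a \<in> carrier R" "c \<in> carrier R" "s \<in> carrier S"
  shows "h a \<otimes>\<^bsub>S\<^esub> hom_eval S h s (c # us)
    = h c \<otimes>\<^bsub>S\<^esub> s [^]\<^bsub>S\<^esub> (length us - length hs) \<otimes>\<^bsub>S\<^esub> hom_eval S h s (a # hs)
      \<oplus>\<^bsub>S\<^esub> hom_eval S h s (pseudo_step R a hs c us)"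
proof -
  have "set (map h us) \<subseteq> carrier S" "set (map h hs) \<subseteq> carrier S" using assms by auto
  then show ?thesis
    using S.eval_pseudo_step[of "map h hs" "map h us" "h a" "h c" s] assms
    by (simp add: hom_eval_def map_pseudo_step)
qed

lemma (in ring_hom_cring) hom_eval_pseudo_step_combine:
  assumes "length hs < length us" "set us \<subseteq> carrier R" "set hs \<subseteq> carrier R"
    and "a \<in> carrier R" "c \<in> carrier R" "s \<in> carrier S" "e \<in> carrier R"
    and "set q \<subseteq> carrier R" "set r \<subseteq> carrier R" "length q = length us - length hs"
    and "h e \<otimes>\<^bsub>S\<^esub> hom_eval S h s (pseudo_step R a hs c us)
       = hom_eval S h s q \<otimes>\<^bsub>S\<^esub> hom_eval S h s (a # hs) \<oplus>\<^bsub>S\<^esub> hom_eval S h s r"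
  shows "h (e \<otimes> a) \<otimes>\<^bsub>S\<^esub> hom_eval S h s (c # us)
       = hom_eval S h s ((e \<otimes> c) # q) \<otimes>\<^bsub>S\<^esub> hom_eval S h s (a # hs) \<oplus>\<^bsub>S\<^esub> hom_eval S h s r"
proof -
  define w where "w = s [^]\<^bsub>S\<^esub> (length us - length hs)"
  define P where "P = hom_eval S h s (pseudo_step R a hs c us)"
  define Q where "Q = hom_eval S h s q"
  define H where "H = hom_eval S h s (a # hs)"
  define T where "T = hom_eval S h s r"
  define G where "G = hom_eval S h s (c # us)"
  have cl: "w \<in> carrier S" "Q \<in> carrier S" "H \<in> carrier S" "T \<in> carrier S" "G \<in> carrier S"
    "P \<in> carrier S" "h e \<in> carrier S" "h a \<in> carrier S" "h c \<in> carrier S"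
    using assms R.pseudo_step_closed[of us hs a c] unfolding w_def P_def Q_def H_def T_def G_def
    by (auto intro!: hom_eval_closed)
  have 1: "h a \<otimes>\<^bsub>S\<^esub> G = h c \<otimes>\<^bsub>S\<^esub> w \<otimes>\<^bsub>S\<^esub> H \<oplus>\<^bsub>S\<^esub> P"
    unfolding G_def H_def P_def w_def by (rule hom_eval_pseudo_step) (use assms in auto)
  have 2: "h e \<otimes>\<^bsub>S\<^esub> P = Q \<otimes>\<^bsub>S\<^esub> H \<oplus>\<^bsub>S\<^esub> T"
    using assms unfolding P_def Q_def H_def T_def by simp
  have 3: "hom_eval S h s ((e \<otimes> c) # q) = h e \<otimes>\<^bsub>S\<^esub> h c \<otimes>\<^bsub>S\<^esub> w \<oplus>\<^bsub>S\<^esub> Q"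
    using assms by (simp add: hom_eval_def w_def Q_def)
  have "h e \<otimes>\<^bsub>S\<^esub> h a \<otimes>\<^bsub>S\<^esub> G = h e \<otimes>\<^bsub>S\<^esub> (h a \<otimes>\<^bsub>S\<^esub> G)" using cl by (simp add: S.m_assoc)
  also have "\<dots> = h e \<otimes>\<^bsub>S\<^esub> (h c \<otimes>\<^bsub>S\<^esub> w \<otimes>\<^bsub>S\<^esub> H) \<oplus>\<^bsub>S\<^esub> h e \<otimes>\<^bsub>S\<^esub> P"
    unfolding 1 using cl by (simp add: S.r_distr)
  also have "\<dots> = (h e \<otimes>\<^bsub>S\<^esub> h c \<otimes>\<^bsub>S\<^esub> w \<oplus>\<^bsub>S\<^esub> Q) \<otimes>\<^bsub>S\<^esub> H \<oplus>\<^bsub>S\<^esub> T"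
    unfolding 2 using cl by algebra
  finally show ?thesis 
    using assms 3 by (simp add: G_def H_def T_def)
qed

lemma (in domain) pow_nonzero:
  "a \<in> carrier R \<Longrightarrow> a \<noteq> \<zero> \<Longrightarrow> a [^] (n::nat) \<noteq> \<zero>"
  by (induction n) (auto simp: integral_iff)

text \<open>
  The same exponent, quotient and remainder serve for both evaluations. This is what makes the
  extension of a homomorphism well defined: a relation that holds at $x$ is divided by the minimal
  relation of $x$, and the result is read off at the image point.
\<close>
lemma pseudo_division:
  assumes "domain R" and "ring_hom_cring R S f" and "ring_hom_cring R T g"
    and "s \<in> carrier S" and "t \<in> carrier T"
    and "a \<in> carrier R" "a \<noteq> \<zero>\<^bsub>R\<^esub>" "set hs \<subseteq> carrier R"
    and "set p \<subseteq> carrier R" "length hs < length p"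
  obtains n :: nat and q r where "set q \<subseteq> carrier R" "set r \<subseteq> carrier R"
    "length r \<le> length hs" "length q = length p - length hs"
    "hd p \<noteq> \<zero>\<^bsub>R\<^esub> \<Longrightarrow> hd q \<noteq> \<zero>\<^bsub>R\<^esub>"
    "f (a [^]\<^bsub>R\<^esub> n) \<otimes>\<^bsub>S\<^esub> hom_eval S f s p
       = hom_eval S f s q \<otimes>\<^bsub>S\<^esub> hom_eval S f s (a # hs) \<oplus>\<^bsub>S\<^esub> hom_eval S f s r"
    "g (a [^]\<^bsub>R\<^esub> n) \<otimes>\<^bsub>T\<^esub> hom_eval T g t p
       = hom_eval T g t q \<otimes>\<^bsub>T\<^esub> hom_eval T g t (a # hs) \<oplus>\<^bsub>T\<^esub> hom_eval T g t r"
proof -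
  interpret R: domain R by fact
  interpret f: ring_hom_cring R S f by fact
  interpret g: ring_hom_cring R T g by fact
  have "\<exists>n q r. set q \<subseteq> carrier R \<and> set r \<subseteq> carrier R \<and> length r \<le> length hs
      \<and> length q = length p - length hs \<and> (hd p \<noteq> \<zero>\<^bsub>R\<^esub> \<longrightarrow> hd q \<noteq> \<zero>\<^bsub>R\<^esub>)
      \<and> f (a [^]\<^bsub>R\<^esub> (n::nat)) \<otimes>\<^bsub>S\<^esub> hom_eval S f s p
       = hom_eval S f s q \<otimes>\<^bsub>S\<^esub> hom_eval S f s (a # hs) \<oplus>\<^bsub>S\<^esub> hom_eval S f s r
      \<and> g (a [^]\<^bsub>R\<^esub> n) \<otimes>\<^bsub>T\<^esub> hom_eval T g t p
       = hom_eval T g t q \<otimes>\<^bsub>T\<^esub> hom_eval T g t (a # hs) \<oplus>\<^bsub>T\<^esub> hom_eval T g t r"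
    using assms(9,10)
  proof (induction "length p" arbitrary: p)
    case 0
    then show ?case by simp
  next
    case (Suc l)
    then obtain c us where p: "p = c # us" by (cases p) auto
    define us' where "us' = pseudo_step R a hs c us"
    have c: "c \<in> carrier R" "set us \<subseteq> carrier R" and l: "length hs \<le> length us"
      using Suc p by auto
    have us': "set us' \<subseteq> carrier R" unfolding us'_def
      using R.pseudo_step_closed c assms by blast
    have len': "length us' = length us" unfolding us'_def using l by (rule length_pseudo_step)
    show ?case
    proof (cases "length hs < length us")
      case True
      from Suc.hyps(1)[of us'] obtain n :: nat and q r where
        IH: "set q \<subseteq> carrier R" "set r \<subseteq> carrier R" "length r \<le> length hs"
          "length q = length us' - length hs" and
        e: "f (a [^]\<^bsub>R\<^esub> n) \<otimes>\<^bsub>S\<^esub> hom_eval S f s us'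
           = hom_eval S f s q \<otimes>\<^bsub>S\<^esub> hom_eval S f s (a # hs) \<oplus>\<^bsub>S\<^esub> hom_eval S f s r"
        "g (a [^]\<^bsub>R\<^esub> n) \<otimes>\<^bsub>T\<^esub> hom_eval T g t us'
           = hom_eval T g t q \<otimes>\<^bsub>T\<^esub> hom_eval T g t (a # hs) \<oplus>\<^bsub>T\<^esub> hom_eval T g t r"
        using Suc True p us' len' by auto
      have nz: "a [^]\<^bsub>R\<^esub> n \<otimes>\<^bsub>R\<^esub> c \<noteq> \<zero>\<^bsub>R\<^esub>" if "c \<noteq> \<zero>\<^bsub>R\<^esub>"
        using that assms R.pow_nonzero[of a n] c R.integral[of "a [^]\<^bsub>R\<^esub> n" c] by auto
      show ?thesis
        using f.hom_eval_pseudo_step_combine[OF True c(2) assms(8,6) c(1) assms(4), of "a [^]\<^bsub>R\<^esub> n" q r]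
          g.hom_eval_pseudo_step_combine[OF True c(2) assms(8,6) c(1) assms(5), of "a [^]\<^bsub>R\<^esub> n" q r]
          IH e nz c assms len' True
        unfolding us'_def[symmetric] p
        by - (rule exI[of _ "Suc n"], rule exI[of _ "(a [^]\<^bsub>R\<^esub> n \<otimes>\<^bsub>R\<^esub> c) # q"],
            rule exI[of _ r], auto)
    next
      case False
      then have l0: "length us = length hs" using l by simp
      have "f a \<otimes>\<^bsub>S\<^esub> hom_eval S f s (c # us)
       = hom_eval S f s [c] \<otimes>\<^bsub>S\<^esub> hom_eval S f s (a # hs) \<oplus>\<^bsub>S\<^esub> hom_eval S f s us'"
        using f.hom_eval_pseudo_step[OF l c(2) assms(8,6) c(1) assms(4)] c l0
        by (simp add: us'_def hom_eval_def)
      moreover have "g a \<otimes>\<^bsub>T\<^esub> hom_eval T g t (c # us)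
       = hom_eval T g t [c] \<otimes>\<^bsub>T\<^esub> hom_eval T g t (a # hs) \<oplus>\<^bsub>T\<^esub> hom_eval T g t us'"
        using g.hom_eval_pseudo_step[OF l c(2) assms(8,6) c(1) assms(5)] c l0
        by (simp add: us'_def hom_eval_def)
      ultimately show ?thesis
        using us' len' l0 c p assms
        by - (rule exI[of _ "1::nat"], rule exI[of _ "[c]"], rule exI[of _ us'], auto)
    qed
  qed
  then show thesis using that by blast
qed

section \<open>Extending a homomorphism to a simple extension\<close>

lemma (in ring) simple_extension_eval_image:
  assumes K: "K \<subseteq> carrier R" and x: "x \<in> carrier R"
  shows "simple_extension K x = {eval g x | g. set g \<subseteq> K}"
proof (intro equalityI subsetI)
  fix y assume "y \<in> simple_extension K x"
  then obtain p where "p \<in> carrier (K[X])" "y = eval p x"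
    using simple_extension_as_eval_img[OF K x] by blast
  then show "y \<in> {eval g x | g. set g \<subseteq> K}"
    using polynomial_incl univ_poly_carrier by blast
next
  have "eval g x \<in> simple_extension K x" if "set g \<subseteq> K" for g
    using that
  proof (induction g rule: rev_induct)
    case (snoc c g)
    then have "set g \<subseteq> carrier R" "c \<in> carrier R" using K by auto
    then show ?case
      using snoc simple_extension.lin[of "eval g x" K x c] by (simp add: eval_append_aux x)
  qed simp
  then show "y \<in> {eval g x | g. set g \<subseteq> K} \<Longrightarrow> y \<in> simple_extension K x" for y
    by blast
qed

text \<open>
  The pairs $(g(x), g^f(s))$ for polynomials $g$ over $A$, generated by Horner's scheme. They form
  the graph of the extension of $f$ that sends $x$ to $s$ whenever such an extension exists, and
  closure under sums and products is easier to see here than on coefficient lists.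
\<close>
inductive_set point_graph ::
    "('a, 'x) ring_scheme \<Rightarrow> ('b, 'y) ring_scheme \<Rightarrow> 'a set \<Rightarrow> ('a \<Rightarrow> 'b) \<Rightarrow> 'a \<Rightarrow> 'b \<Rightarrow> ('a \<times> 'b) set"
  for R S A f x s where
  zero: "(\<zero>\<^bsub>R\<^esub>, \<zero>\<^bsub>S\<^esub>) \<in> point_graph R S A f x s"
| lin: "(y, z) \<in> point_graph R S A f x s \<Longrightarrow> c \<in> A
    \<Longrightarrow> (y \<otimes>\<^bsub>R\<^esub> x \<oplus>\<^bsub>R\<^esub> c, z \<otimes>\<^bsub>S\<^esub> s \<oplus>\<^bsub>S\<^esub> f c) \<in> point_graph R S A f x s"

locale point_lift = R?: domain R + S?: cring S for R (structure) and S (structure) +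
  fixes A f x s
  assumes subring_A: "subring A R"
    and hom_f: "f \<in> ring_hom (R\<lparr>carrier := A\<rparr>) S"
    and x_closed: "x \<in> carrier R" and s_closed: "s \<in> carrier S"
begin

abbreviation "G \<equiv> point_graph R S A f x s"

lemma A_sub: "c \<in> A \<Longrightarrow> c \<in> carrier R"
  using subringE(1)[OF subring_A] by blast

lemma hom_cring_f: "ring_hom_cring (R\<lparr>carrier := A\<rparr>) S f"
proof -
  interpret A: domain "R\<lparr>carrier := A\<rparr>" by (rule subring_is_domain[OF subring_A])
  show ?thesis by unfold_locales (rule hom_f)
qed

interpretation f: ring_hom_cring "R\<lparr>carrier := A\<rparr>" S f by (rule hom_cring_f)

lemma f_simps:
  "c \<in> A \<Longrightarrow> f c \<in> carrier S"
  "c \<in> A \<Longrightarrow> d \<in> A \<Longrightarrow> f (c \<oplus> d) = f c \<oplus>\<^bsub>S\<^esub> f d"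
  "c \<in> A \<Longrightarrow> d \<in> A \<Longrightarrow> f (c \<otimes> d) = f c \<otimes>\<^bsub>S\<^esub> f d"
  "f \<one> = \<one>\<^bsub>S\<^esub>" "f \<zero> = \<zero>\<^bsub>S\<^esub>"
  using f.hom_closed f.hom_add f.hom_mult f.hom_one f.hom_zero by simp_all

lemma graph_closed: "(y, z) \<in> G \<Longrightarrow> y \<in> carrier R \<and> z \<in> carrier S"
  by (induction rule: point_graph.induct) (auto simp: x_closed s_closed A_sub f_simps)

lemma graph_eval:
  "set g \<subseteq> A \<Longrightarrow> (R.eval g x, hom_eval S f s g) \<in> G"
proof (induction g rule: rev_induct)
  case Nil
  then show ?case by (simp add: hom_eval_def point_graph.zero)
next
  case (snoc c g)
  then have "c \<in> A" "set g \<subseteq> A" by auto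
  moreover have "set g \<subseteq> carrier R" "set (map f g) \<subseteq> carrier S"
    using \<open>set g \<subseteq> A\<close> A_sub f_simps by auto
  ultimately show ?case
    using snoc point_graph.lin[of "R.eval g x" "hom_eval S f s g" R S A f x s c]
    by (simp add: hom_eval_def R.eval_append_aux A_sub x_closed s_closed f_simps S.eval_append_aux)
qed

lemma graph_eval_ex:
  "(y, z) \<in> G \<Longrightarrow> \<exists>g. set g \<subseteq> A \<and> y = R.eval g x \<and> z = hom_eval S f s g"
proof (induction rule: point_graph.induct)
  case zero
  show ?case by (rule exI[of _ "[]"]) (simp add: hom_eval_def)
next
  case (lin y z c)
  then obtain g where g: "set g \<subseteq> A" "y = R.eval g x" "z = hom_eval S f s g" by blast
  then have "set g \<subseteq> carrier R" "set (map f g) \<subseteq> carrier S"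
    using A_sub f_simps by auto
  then show ?case using g lin
    by (intro exI[of _ "g @ [c]"])
      (simp add: hom_eval_def R.eval_append_aux A_sub x_closed s_closed f_simps S.eval_append_aux)
qed

lemma graph_add: "(y, z) \<in> G \<Longrightarrow> (y', z') \<in> G \<Longrightarrow> (y \<oplus> y', z \<oplus>\<^bsub>S\<^esub> z') \<in> G"
proof (induction arbitrary: y' z' rule: point_graph.induct)
  case zero
  then show ?case using graph_closed[OF zero] by simp
next
  case (lin y z c)
  have yz: "y \<in> carrier R" "z \<in> carrier S" "c \<in> carrier R" "f c \<in> carrier S"
    using graph_closed[OF lin.hyps(1)] lin A_sub f_simps by auto
  from lin.prems show ?case
  proof (cases rule: point_graph.cases)
    case zero
    then show ?thesis using point_graph.lin[OF lin.hyps] yz x_closed s_closed by simp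
  next
    case (lin y2 z2 c2)
    have yz2: "y2 \<in> carrier R" "z2 \<in> carrier S" "c2 \<in> carrier R" "f c2 \<in> carrier S"
      using graph_closed[OF lin(3)] lin A_sub f_simps by auto
    have cc: "c \<oplus> c2 \<in> A" using lin.hyps lin subringE(7)[OF subring_A] by auto
    have "((y \<oplus> y2) \<otimes> x \<oplus> (c \<oplus> c2), (z \<oplus>\<^bsub>S\<^esub> z2) \<otimes>\<^bsub>S\<^esub> s \<oplus>\<^bsub>S\<^esub> f (c \<oplus> c2)) \<in> G"
      by (rule point_graph.lin[OF lin.IH[OF lin(3)] cc])
    moreover have "(y \<oplus> y2) \<otimes> x \<oplus> (c \<oplus> c2) = (y \<otimes> x \<oplus> c) \<oplus> (y2 \<otimes> x \<oplus> c2)"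
      using yz yz2 x_closed by algebra
    moreover have "(z \<oplus>\<^bsub>S\<^esub> z2) \<otimes>\<^bsub>S\<^esub> s \<oplus>\<^bsub>S\<^esub> f (c \<oplus> c2)
        = (z \<otimes>\<^bsub>S\<^esub> s \<oplus>\<^bsub>S\<^esub> f c) \<oplus>\<^bsub>S\<^esub> (z2 \<otimes>\<^bsub>S\<^esub> s \<oplus>\<^bsub>S\<^esub> f c2)"
      unfolding f_simps(2)[OF lin.hyps(2) lin(4)] using yz yz2 s_closed by algebra
    ultimately show ?thesis using lin by simp
  qed
qed

lemma graph_scalar: "(y, z) \<in> G \<Longrightarrow> d \<in> A \<Longrightarrow> (d \<otimes> y, f d \<otimes>\<^bsub>S\<^esub> z) \<in> G"
proof (induction rule: point_graph.induct)
  case zero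
  then show ?case using point_graph.zero[of R S A f x s] A_sub f_simps by simp
next
  case (lin y z c)
  have cl: "y \<in> carrier R" "z \<in> carrier S" "c \<in> carrier R" "f c \<in> carrier S" "d \<in> carrier R" "f d \<in> carrier S"
    using graph_closed[OF lin.hyps(1)] lin A_sub f_simps by auto
  have "d \<otimes> c \<in> A" using lin subringE(6)[OF subring_A] by auto
  from point_graph.lin[OF lin.IH[OF lin.prems] this]
  have "(d \<otimes> y \<otimes> x \<oplus> d \<otimes> c, f d \<otimes>\<^bsub>S\<^esub> z \<otimes>\<^bsub>S\<^esub> s \<oplus>\<^bsub>S\<^esub> f d \<otimes>\<^bsub>S\<^esub> f c) \<in> G"
    using lin f_simps by simp
  moreover have "d \<otimes> y \<otimes> x \<oplus> d \<otimes> c = d \<otimes> (y \<otimes> x \<oplus> c)" using cl x_closed by algebra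
  moreover have "f d \<otimes>\<^bsub>S\<^esub> z \<otimes>\<^bsub>S\<^esub> s \<oplus>\<^bsub>S\<^esub> f d \<otimes>\<^bsub>S\<^esub> f c = f d \<otimes>\<^bsub>S\<^esub> (z \<otimes>\<^bsub>S\<^esub> s \<oplus>\<^bsub>S\<^esub> f c)"
    using cl s_closed by algebra
  ultimately show ?case by simp
qed

lemma graph_mult: "(y, z) \<in> G \<Longrightarrow> (y', z') \<in> G \<Longrightarrow> (y \<otimes> y', z \<otimes>\<^bsub>S\<^esub> z') \<in> G"
proof (induction rule: point_graph.induct)
  case zero
  then show ?case using graph_closed[OF zero] point_graph.zero[of R S A f x s] by simp
next
  case (lin y z c)
  have cl: "y \<in> carrier R" "z \<in> carrier S" "c \<in> carrier R" "f c \<in> carrier S" "y' \<in> carrier R" "z' \<in> carrier S"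
    using graph_closed[OF lin.hyps(1)] graph_closed[OF lin.prems] lin A_sub f_simps by auto
  have "(y \<otimes> y' \<otimes> x \<oplus> \<zero>, z \<otimes>\<^bsub>S\<^esub> z' \<otimes>\<^bsub>S\<^esub> s \<oplus>\<^bsub>S\<^esub> f \<zero>) \<in> G"
    by (rule point_graph.lin[OF lin.IH[OF lin.prems] subringE(2)[OF subring_A]])
  from graph_add[OF this graph_scalar[OF lin.prems lin.hyps(2)]]
  have "((y \<otimes> y' \<otimes> x \<oplus> \<zero>) \<oplus> c \<otimes> y', (z \<otimes>\<^bsub>S\<^esub> z' \<otimes>\<^bsub>S\<^esub> s \<oplus>\<^bsub>S\<^esub> \<zero>\<^bsub>S\<^esub>) \<oplus>\<^bsub>S\<^esub> f c \<otimes>\<^bsub>S\<^esub> z') \<in> G"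
    unfolding f_simps .
  moreover have "(y \<otimes> y' \<otimes> x \<oplus> \<zero>) \<oplus> c \<otimes> y' = (y \<otimes> x \<oplus> c) \<otimes> y'"
    using cl x_closed by algebra
  moreover have "(z \<otimes>\<^bsub>S\<^esub> z' \<otimes>\<^bsub>S\<^esub> s \<oplus>\<^bsub>S\<^esub> \<zero>\<^bsub>S\<^esub>) \<oplus>\<^bsub>S\<^esub> f c \<otimes>\<^bsub>S\<^esub> z' = (z \<otimes>\<^bsub>S\<^esub> s \<oplus>\<^bsub>S\<^esub> f c) \<otimes>\<^bsub>S\<^esub> z'"
    using cl s_closed by algebra
  ultimately show ?case by simp
qed

lemma graph_domain: "R.simple_extension A x = fst ` G"
proof
  show "R.simple_extension A x \<subseteq> fst ` G"
  proof
    fix y assume "y \<in> R.simple_extension A x"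
    then have "\<exists>z. (y, z) \<in> G"
      by (induction rule: R.simple_extension.induct) (blast intro: point_graph.intros)+
    then show "y \<in> fst ` G" by force
  qed
next
  have "y \<in> R.simple_extension A x" if "(y, z) \<in> G" for y z
    using that by (induction rule: point_graph.induct) (auto intro: R.simple_extension.intros)
  then show "fst ` G \<subseteq> R.simple_extension A x" by auto
qed

text \<open>
  The graph is closed under differences, so two values over one point differ by the
  value of a relation satisfied by $x$. It is therefore functional as soon as $s$ satisfies the
  images of all relations satisfied by $x$.
\<close>
lemma hom_extends:
  assumes rel: "\<And>g. set g \<subseteq> A \<Longrightarrow> R.eval g x = \<zero> \<Longrightarrow> hom_eval S f s g = \<zero>\<^bsub>S\<^esub>"
  obtains h where "h \<in> ring_hom (R\<lparr>carrier := R.simple_extension A x\<rparr>) S"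
    "\<And>g. set g \<subseteq> A \<Longrightarrow> h (R.eval g x) = hom_eval S f s g"
    "\<And>c. c \<in> A \<Longrightarrow> h c = f c"
proof -
  have unique: "z = z'" if "(y, z) \<in> G" "(y, z') \<in> G" for y z z'
  proof -
    have "\<ominus> \<one> \<in> A" using subringE(3,5)[OF subring_A] by auto
    then have "(\<ominus> \<one> \<otimes> y, f (\<ominus> \<one>) \<otimes>\<^bsub>S\<^esub> z) \<in> G" using graph_scalar that by blast
    moreover have "f (\<ominus> \<one>) = \<ominus>\<^bsub>S\<^esub> \<one>\<^bsub>S\<^esub>"
    proof -
      have "f (\<ominus> \<one>) \<oplus>\<^bsub>S\<^esub> f \<one> = \<zero>\<^bsub>S\<^esub>"
        using f_simps(2)[of "\<ominus> \<one>" \<one>] \<open>\<ominus> \<one> \<in> A\<close> subringE(3)[OF subring_A] f_simps(5) R.l_neg by auto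
      then show ?thesis
        using f_simps \<open>\<ominus> \<one> \<in> A\<close> S.minus_equality by fastforce
    qed
    ultimately have "(\<ominus> \<one> \<otimes> y \<oplus> y, \<ominus>\<^bsub>S\<^esub> \<one>\<^bsub>S\<^esub> \<otimes>\<^bsub>S\<^esub> z \<oplus>\<^bsub>S\<^esub> z') \<in> G"
      using graph_add that by simp
    moreover have "\<ominus> \<one> \<otimes> y \<oplus> y = \<zero>" 
      using graph_closed[OF that(1)] by algebra
    ultimately obtain g where "set g \<subseteq> A" "R.eval g x = \<zero>" "hom_eval S f s g = \<ominus>\<^bsub>S\<^esub> \<one>\<^bsub>S\<^esub> \<otimes>\<^bsub>S\<^esub> z \<oplus>\<^bsub>S\<^esub> z'"
      using graph_eval_ex by metis
    then have "\<ominus>\<^bsub>S\<^esub> \<one>\<^bsub>S\<^esub> \<otimes>\<^bsub>S\<^esub> z \<oplus>\<^bsub>S\<^esub> z' = \<zero>\<^bsub>S\<^esub>" using rel by metis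
    then have "\<ominus>\<^bsub>S\<^esub> z \<oplus>\<^bsub>S\<^esub> z' = \<zero>\<^bsub>S\<^esub>"
      using graph_closed[OF that(1)] by (simp add: S.l_minus)
    then show "z = z'"
      using graph_closed[OF that(1)] graph_closed[OF that(2)]
      by (metis S.a_inv_closed S.minus_equality S.minus_minus S.add.m_comm)
  qed
  define h where "h y = (THE z. (y, z) \<in> G)" for y
  have h: "h y = z" if "(y, z) \<in> G" for y z
    unfolding h_def using that unique by blast
  have hG: "(y, h y) \<in> G" if "y \<in> R.simple_extension A x" for y
    using that h unfolding graph_domain by auto
  have hA: "h c = f c" if "c \<in> A" for c
    using h[OF graph_eval[of "[c]"]] that A_sub f_simps by (simp add: hom_eval_def)
  have "h \<in> ring_hom (R\<lparr>carrier := R.simple_extension A x\<rparr>) S"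
  proof (rule ring_hom_memI)
    fix y assume "y \<in> carrier (R\<lparr>carrier := R.simple_extension A x\<rparr>)"
    then show "h y \<in> carrier S" using hG graph_closed by auto
  next
    fix y z assume "y \<in> carrier (R\<lparr>carrier := R.simple_extension A x\<rparr>)"
      "z \<in> carrier (R\<lparr>carrier := R.simple_extension A x\<rparr>)"
    then have "(y, h y) \<in> G" "(z, h z) \<in> G" using hG by auto
    then show "h (y \<otimes>\<^bsub>R\<lparr>carrier := R.simple_extension A x\<rparr>\<^esub> z) = h y \<otimes>\<^bsub>S\<^esub> h z"
      "h (y \<oplus>\<^bsub>R\<lparr>carrier := R.simple_extension A x\<rparr>\<^esub> z) = h y \<oplus>\<^bsub>S\<^esub> h z"
      using h[OF graph_mult] h[OF graph_add] by auto
  next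
    show "h \<one>\<^bsub>R\<lparr>carrier := R.simple_extension A x\<rparr>\<^esub> = \<one>\<^bsub>S\<^esub>"
      using hA[of \<one>] subringE(3)[OF subring_A] f_simps by simp
  qed
  then show thesis using that h[OF graph_eval] hA by blast
qed

end

text \<open>
  A nonzero element $b$ of $A[x]$ has a nonzero multiple in $A$ if $x$ is algebraic over $A$.
  Among the polynomials whose value at $x$ is a nonzero multiple of $b$ one takes $h$ of minimal
  length. Reducing $h$ by the minimal relation $p$ of $x$ shows that $h$ is shorter
  than $p$. Then $p$ is divided by $h$: the remainder has value zero by minimality of $h$, so the
  quotient has value zero, so the quotient is as long as $p$ by minimality of $p$, and $h$ is constant.
\<close>
lemma (in domain) minimal_annihilator_multiple:
  assumes A: "subring A R" and x: "x \<in> carrier R"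
    and p: "set (a # hs) \<subseteq> A" "a \<noteq> \<zero>" "eval (a # hs) x = \<zero>"
    and min: "\<And>g. set g \<subseteq> A \<Longrightarrow> length g \<le> length hs \<Longrightarrow> eval g x = \<zero> \<Longrightarrow> set g \<subseteq> {\<zero>}"
    and b: "b \<in> simple_extension A x" "b \<noteq> \<zero>"
  obtains d e where "d \<in> A" "d \<noteq> \<zero>" "e \<in> simple_extension A x" "d = b \<otimes> e"
proof -
  interpret A: domain "R\<lparr>carrier := A\<rparr>" by (rule subring_is_domain[OF A])
  have AR: "A \<subseteq> carrier R" using subringE(1)[OF A] .
  have id_hom: "id \<in> ring_hom (R\<lparr>carrier := A\<rparr>) R"
    using AR by (auto intro!: ring_hom_memI)
  have id_ring_hom_cring: "ring_hom_cring (R\<lparr>carrier := A\<rparr>) R id"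
    by (intro ring_hom_cring.intro ring_hom_cring_axioms.intro A.is_cring is_cring id_hom)
  have ev: "hom_eval R id x g = eval g x" for g by (simp add: hom_eval_def)
  define B where "B = simple_extension A x"
  have B: "subring B R" unfolding B_def by (rule simple_extension_is_subring[OF A x])
  have BR: "B \<subseteq> carrier R" using subringE(1)[OF B] .
  have evB: "eval g x \<in> B" if "set g \<subseteq> A" for g
    unfolding B_def simple_extension_eval_image[OF AR x] using that by blast
  have AB: "A \<subseteq> B" unfolding B_def using simple_extension_incl[OF AR x] .
  have powA: "c [^] (n::nat) \<in> A" if "c \<in> A" for c n
    using that by (induction n) (auto intro: subringE(3,6)[OF A])
  \<comment> \<open>Only the value at $x$ matters here, so both evaluations of the division are taken to be this one.\<close>
  have division: "\<exists>(n::nat) q r. set q \<subseteq> A \<and> set r \<subseteq> A \<and> length r \<le> length ks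
      \<and> length q = length g - length ks \<and> (hd g \<noteq> \<zero> \<longrightarrow> hd q \<noteq> \<zero>)
      \<and> c [^] n \<otimes> eval g x = eval q x \<otimes> eval (c # ks) x \<oplus> eval r x"
    if "set (c # ks) \<subseteq> A" "c \<noteq> \<zero>" "set g \<subseteq> A" "length ks < length g" for c ks g
  proof -
    have pow: "c [^]\<^bsub>R\<lparr>carrier := A\<rparr>\<^esub> n = c [^] n" for n :: nat
      by (rule nat_pow_consistent[symmetric])
    have "c \<in> carrier (R\<lparr>carrier := A\<rparr>)" "c \<noteq> \<zero>\<^bsub>R\<lparr>carrier := A\<rparr>\<^esub>"
      "set ks \<subseteq> carrier (R\<lparr>carrier := A\<rparr>)" "set g \<subseteq> carrier (R\<lparr>carrier := A\<rparr>)"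
      using that by simp_all
    then show ?thesis
    proof (rule pseudo_division[OF A.domain_axioms id_ring_hom_cring id_ring_hom_cring x x _ _ _ _ that(4)])
      fix n :: nat and q r
      assume "set q \<subseteq> carrier (R\<lparr>carrier := A\<rparr>)" "set r \<subseteq> carrier (R\<lparr>carrier := A\<rparr>)"
        "length r \<le> length ks" "length q = length g - length ks"
        "hd g \<noteq> \<zero>\<^bsub>R\<lparr>carrier := A\<rparr>\<^esub> \<Longrightarrow> hd q \<noteq> \<zero>\<^bsub>R\<lparr>carrier := A\<rparr>\<^esub>"
        "id (c [^]\<^bsub>R\<lparr>carrier := A\<rparr>\<^esub> n) \<otimes> hom_eval R id x g
          = hom_eval R id x q \<otimes> hom_eval R id x (c # ks) \<oplus> hom_eval R id x r"
      then show ?thesis unfolding ev id_apply pow by auto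
    qed
  qed
  \<comment> \<open>The candidates for a constant multiple of $b$; the minimal one will be shown to be constant.\<close>
  define Q where "Q h \<longleftrightarrow> set h \<subseteq> A \<and> eval h x \<noteq> \<zero> \<and> (\<exists>e\<in>B. eval h x = b \<otimes> e)" for h
  obtain g where g: "set g \<subseteq> A" "b = eval g x" using b
    unfolding simple_extension_eval_image[OF AR x] by blast
  have bR: "b \<in> carrier R" "b \<in> B" using b BR by (auto simp: B_def)
  have "Q g" unfolding Q_def
    using g b bR subringE(3)[OF B] r_one[of b] by (auto intro!: bexI[of _ \<one>])
  then obtain h where h: "Q h" and hmin: "\<And>h'. length h' < length h \<Longrightarrow> \<not> Q h'"
    using ex_has_least_nat[of Q g length] by (meson not_le)
  from h obtain e where hA: "set h \<subseteq> A" and hnz: "eval h x \<noteq> \<zero>" and e: "e \<in> B" "eval h x = b \<otimes> e"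
    unfolding Q_def by auto
  obtain c ks where hc: "h = c # ks" using hnz by (cases h) auto
  have c0: "c \<noteq> \<zero>"
  proof
    assume "c = \<zero>"
    moreover have "eval ks x \<in> carrier R" using hA hc AR x by (auto intro: eval_in_carrier)
    ultimately have "eval ks x = eval h x" using hc x by simp
    then have "Q ks" using h hc unfolding Q_def by auto
    then show False using hmin[of ks] hc by simp
  qed
  \<comment> \<open>Otherwise the remainder of $h$ modulo the minimal relation would be a shorter candidate.\<close>
  have short: "length h \<le> length hs"
  proof (rule ccontr)
    assume "\<not> length h \<le> length hs"
    then have "length hs < length h" by simp
    from division[OF p(1,2) hA this] obtain n :: nat and q r where
      qr: "set q \<subseteq> A" "set r \<subseteq> A" "length r \<le> length hs"
      "a [^] n \<otimes> eval h x = eval q x \<otimes> eval (a # hs) x \<oplus> eval r x" by blast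
    have cl: "eval q x \<in> carrier R" "eval r x \<in> carrier R" "a [^] n \<in> A"
      using qr evB BR p powA by auto
    then have r: "eval r x = a [^] n \<otimes> eval h x" using qr p by simp
    moreover have "a [^] n \<otimes> eval h x \<noteq> \<zero>"
    proof -
      have "a \<in> carrier R" "eval h x \<in> carrier R" using p AR hA evB BR by auto
      then show ?thesis using hnz integral_iff pow_nonzero[of a n] p by simp
    qed
    moreover have "a [^] n \<otimes> eval h x = b \<otimes> (a [^] n \<otimes> e)"
      using e bR BR cl AR m_lcomm[of "a [^] n" b e] by auto
    moreover have "a [^] n \<otimes> e \<in> B" using subringE(6)[OF B] cl AB e by auto
    ultimately have "Q r" unfolding Q_def using qr by metis
    then show False using hmin[of r] qr \<open>length hs < length h\<close> by simp
  qed
  have "length ks < length (a # hs)" using short hc by simp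
  from division[OF _ c0 p(1) this] hA hc obtain n :: nat and q r where
      qr: "set q \<subseteq> A" "set r \<subseteq> A" "length r \<le> length ks" "length q = length (a # hs) - length ks"
      "hd q \<noteq> \<zero>" and eq: "c [^] n \<otimes> eval (a # hs) x = eval q x \<otimes> eval h x \<oplus> eval r x" 
    using p by auto
  have cl: "eval q x \<in> carrier R" "eval r x \<in> carrier R" "eval h x \<in> carrier R" "c [^] n \<in> carrier R"
    using qr evB[OF qr(1)] evB[OF qr(2)] evB[OF hA] BR hA hc powA AR by (auto simp del: eval.simps)
  have eq0: "eval q x \<otimes> eval h x \<oplus> eval r x = \<zero>" using eq p cl by simp
  \<comment> \<open>The remainder is a multiple of $b$ too, and shorter than $h$.\<close>
  have r0: "eval r x = \<zero>"
  proof (rule ccontr)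
    assume "eval r x \<noteq> \<zero>"
    have ne: "e \<in> carrier R" "\<ominus> (eval q x) \<in> B" using e BR qr evB subringE(5)[OF B] by auto
    have "eval r x = b \<otimes> (\<ominus> (eval q x) \<otimes> e)"
    proof -
      have "eval r x \<oplus> eval q x \<otimes> eval h x = \<zero>" using eq0 cl a_comm by simp
      then have "eval r x = \<ominus> (eval q x \<otimes> eval h x)"
        using cl minus_equality[of "eval r x" "eval q x \<otimes> eval h x"] by simp
      also have "\<dots> = \<ominus> (eval q x \<otimes> (b \<otimes> e))" using e by simp
      also have "\<dots> = b \<otimes> (\<ominus> (eval q x) \<otimes> e)" using cl ne bR by algebra
      finally show ?thesis .
    qed
    moreover have "\<ominus> (eval q x) \<otimes> e \<in> B" using subringE(6)[OF B] ne e by auto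
    ultimately have "Q r" unfolding Q_def using qr \<open>eval r x \<noteq> \<zero>\<close> by blast
    then show False using hmin[of r] qr hc by simp
  qed
  then have "eval q x \<otimes> eval h x = \<zero>" using eq0 cl by simp
  then have "eval q x = \<zero>" using integral cl hnz by blast
  have "\<not> length q \<le> length hs"
  proof
    assume "length q \<le> length hs"
    from min[OF qr(1) this \<open>eval q x = \<zero>\<close>] have "set q \<subseteq> {\<zero>}" .
    moreover have "q \<noteq> []" using qr(4) short hc by auto
    ultimately show False using qr(5) by (cases q) auto
  qed
  then have "ks = []" using qr(4) by (cases ks) auto
  then have "eval h x = c" "c \<in> A" using hc hA AR by auto
  moreover have "c = b \<otimes> e" using e(2) unfolding \<open>eval h x = c\<close> .
  ultimately show thesis using that c0 e(1) unfolding B_def by blast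
qed

section \<open>The Nullstellensatz and the Jacobson property\<close>

lemma (in algebraically_closed) exists_root:
  assumes "set p \<subseteq> carrier L" "2 \<le> length p" "hd p \<noteq> \<zero>"
  obtains z where "z \<in> carrier L" "eval p z = \<zero>"
proof -
  have p: "p \<in> carrier (poly_ring L)"
    using assms by (auto simp: univ_poly_carrier[symmetric] polynomial_def)
  then have "size (roots p) = length p - 1"
    using roots_over_carrier by (simp add: splitted_def)
  then obtain z where "z \<in># roots p" using assms by fastforce
  then have "is_root p z" using roots_mem_iff_is_root[OF p] by blast
  then show thesis using that by (auto simp: is_root_def)
qed

lemma (in domain) exists_nonroot:
  assumes "infinite (carrier R)" "set p \<subseteq> carrier R" "p \<noteq> []" "hd p \<noteq> \<zero>"
  obtains z where "z \<in> carrier R" "eval p z \<noteq> \<zero>"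
proof -
  have p: "p \<in> carrier (poly_ring R)"
    using assms by (auto simp: univ_poly_carrier[symmetric] polynomial_def)
  have "\<not> carrier R \<subseteq> {x. is_root p x}"
    using finite_number_of_roots[OF p] assms(1) finite_subset by blast
  then show thesis using that assms(3) by (auto simp: is_root_def)
qed

lemma (in field) char_zero_imp_infinite:
  assumes "char_zero R"
  shows "infinite (carrier R)"
proof -
  have "inj (\<lambda>n::nat. [n] \<cdot> \<one>)"
  proof (rule linorder_injI)
    fix i j :: nat assume "i < j"
    have sum: "[i] \<cdot> \<one> \<oplus> [(j - i)] \<cdot> \<one> = [j] \<cdot> \<one>"
      using \<open>i < j\<close> add.nat_pow_mult[of \<one> i "j - i"] by simp
    have nz: "[(j - i)] \<cdot> \<one> \<noteq> \<zero>" using assms \<open>i < j\<close> by (simp add: char_zero_def)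
    have "[i] \<cdot> \<one> \<in> carrier R" "[(j - i)] \<cdot> \<one> \<in> carrier R" by simp_all
    then show "[i] \<cdot> \<one> \<noteq> [j] \<cdot> \<one>"
      using sum nz by (simp flip: sum)
  qed
  moreover have "range (\<lambda>n::nat. [n] \<cdot> \<one>) \<subseteq> carrier R" by auto
  ultimately show ?thesis
    using finite_subset range_inj_infinite by blast
qed

lemma (in ring) eval_zeros: "set g \<subseteq> {\<zero>} \<Longrightarrow> z \<in> carrier R \<Longrightarrow> eval g z = \<zero>"
  by (induction g) auto

text \<open>
  If $x$ satisfies no relation over $A$, then $a$ is the leading coefficient of a polynomial with
  value $b$, and $x$ goes to a point of the infinite field $K$ where the image of that polynomial
  does not vanish. Otherwise $a$ is the product of the leading coefficient of a minimal relation
  of $x$ and a nonzero multiple $d$ of $b$ in $A$. The first factor ensures that the image of the relation still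
  has positive degree and hence a root in $K$, the second that $b$ survives.
\<close>
lemma extend_hom_to_simple_extension:
  assumes R: "domain R" and K: "algebraically_closed K" "infinite (carrier K)"
    and A: "subring A R" and x: "x \<in> carrier R"
    and b: "b \<in> ring.simple_extension R A x" "b \<noteq> \<zero>\<^bsub>R\<^esub>"
  obtains a where "a \<in> A" "a \<noteq> \<zero>\<^bsub>R\<^esub>"
    "\<And>f. f \<in> ring_hom (R\<lparr>carrier := A\<rparr>) K \<Longrightarrow> f a \<noteq> \<zero>\<^bsub>K\<^esub> \<Longrightarrow>
       \<exists>h \<in> ring_hom (R\<lparr>carrier := ring.simple_extension R A x\<rparr>) K.
         (\<forall>c\<in>A. h c = f c) \<and> h b \<noteq> \<zero>\<^bsub>K\<^esub>"
proof -
  interpret R: domain R by fact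
  interpret K: algebraically_closed K by fact
  have AR: "A \<subseteq> carrier R" using subringE(1)[OF A] .
  have evR: "R.eval g x \<in> carrier R" if "set g \<subseteq> A" for g
    using that AR x by (intro R.eval_in_carrier) auto
  \<comment> \<open>The nontrivial relations of $x$ over $A$, as unnormalised coefficient lists.\<close>
  define Ann where "Ann g \<longleftrightarrow> set g \<subseteq> A \<and> R.eval g x = \<zero>\<^bsub>R\<^esub> \<and> \<not> set g \<subseteq> {\<zero>\<^bsub>R\<^esub>}" for g
  have lift: "point_lift R K A f x s" if "f \<in> ring_hom (R\<lparr>carrier := A\<rparr>) K" "s \<in> carrier K" for f s
    by (intro point_lift.intro point_lift_axioms.intro R.domain_axioms K.is_cring A that x)
  have fK: "set (map f g) \<subseteq> carrier K" if "f \<in> ring_hom (R\<lparr>carrier := A\<rparr>) K" "set g \<subseteq> A" for f g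
    using that ring_hom_closed[OF that(1)] by auto
  have f0: "f \<zero>\<^bsub>R\<^esub> = \<zero>\<^bsub>K\<^esub>" if "f \<in> ring_hom (R\<lparr>carrier := A\<rparr>) K" for f
    using point_lift.f_simps(5)[OF lift[OF that K.zero_closed]] .
  show thesis
  proof (cases "\<exists>p. Ann p")
    case False
    \<comment> \<open>The transcendental case. Minimal length makes the leading coefficient of $g$ nonzero.\<close>
    obtain g0 where "set g0 \<subseteq> A \<and> b = R.eval g0 x"
      using b R.simple_extension_eval_image[OF AR x] by auto
    then obtain g where g: "set g \<subseteq> A" "b = R.eval g x"
      and gmin: "\<And>g'. length g' < length g \<Longrightarrow> \<not> (set g' \<subseteq> A \<and> b = R.eval g' x)"
      using ex_has_least_nat[of "\<lambda>g. set g \<subseteq> A \<and> b = R.eval g x" g0 length] by (metis (no_types, lifting) not_le)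
    obtain c us where c: "g = c # us" using g b by (cases g) auto
    have "c \<noteq> \<zero>\<^bsub>R\<^esub>"
    proof
      assume "c = \<zero>\<^bsub>R\<^esub>"
      then have "b = R.eval us x" using g c evR[of us] x by auto
      then show False using gmin[of us] g c by auto
    qed
    show thesis
    proof (rule that[of c])
      show "c \<in> A" "c \<noteq> \<zero>\<^bsub>R\<^esub>" using g c \<open>c \<noteq> \<zero>\<^bsub>R\<^esub>\<close> by auto
      fix f assume f: "f \<in> ring_hom (R\<lparr>carrier := A\<rparr>) K" "f c \<noteq> \<zero>\<^bsub>K\<^esub>"
      obtain s where s: "s \<in> carrier K" "K.eval (map f g) s \<noteq> \<zero>\<^bsub>K\<^esub>"
        using K.exists_nonroot[OF K(2) fK[OF f(1) g(1)]] f c by auto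
      have "hom_eval K f s g' = \<zero>\<^bsub>K\<^esub>" if "set g' \<subseteq> A" "R.eval g' x = \<zero>\<^bsub>R\<^esub>" for g'
      proof -
        have "set g' \<subseteq> {\<zero>\<^bsub>R\<^esub>}" using that False Ann_def by blast
        then have "set (map f g') \<subseteq> {\<zero>\<^bsub>K\<^esub>}" using f0[OF f(1)] by auto
        then show ?thesis unfolding hom_eval_def using K.eval_zeros s by blast
      qed
      then obtain h where "h \<in> ring_hom (R\<lparr>carrier := R.simple_extension A x\<rparr>) K"
        "\<And>g. set g \<subseteq> A \<Longrightarrow> h (R.eval g x) = hom_eval K f s g" "\<And>c. c \<in> A \<Longrightarrow> h c = f c"
        using point_lift.hom_extends[OF lift[OF f(1) s(1)]] by metis
      then show "\<exists>h \<in> ring_hom (R\<lparr>carrier := R.simple_extension A x\<rparr>) K.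
         (\<forall>c\<in>A. h c = f c) \<and> h b \<noteq> \<zero>\<^bsub>K\<^esub>"
        using g s by (intro bexI[of _ h]) (auto simp: hom_eval_def)
    qed
  next
    case True
    \<comment> \<open>The algebraic case. A shortest relation starts with a nonzero coefficient and is not constant.\<close>
    then obtain p where p: "Ann p" and pmin: "\<And>g. length g < length p \<Longrightarrow> \<not> Ann g"
      using ex_has_least_nat[of Ann _ length] by (metis not_le)
    then obtain a hs where ah: "p = a # hs" by (cases p) (auto simp: Ann_def)
    have pA: "set (a # hs) \<subseteq> A" and p0: "R.eval (a # hs) x = \<zero>\<^bsub>R\<^esub>"
      using p ah by (auto simp: Ann_def)
    have min: "set g \<subseteq> {\<zero>\<^bsub>R\<^esub>}" if "set g \<subseteq> A" "length g \<le> length hs" "R.eval g x = \<zero>\<^bsub>R\<^esub>" for g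
      using pmin[of g] that ah by (auto simp: Ann_def)
    have a0: "a \<noteq> \<zero>\<^bsub>R\<^esub>"
    proof
      assume a: "a = \<zero>\<^bsub>R\<^esub>"
      then have "R.eval hs x = \<zero>\<^bsub>R\<^esub>" using p0 pA evR[of hs] x by simp
      then have "set hs \<subseteq> {\<zero>\<^bsub>R\<^esub>}" using min[of hs] pA by auto
      then show False using p a ah by (auto simp: Ann_def)
    qed
    have aR: "a \<in> A" "a \<in> carrier R" using pA AR by auto
    have hs: "hs \<noteq> []"
    proof
      assume "hs = []"
      then show False using p0 a0 aR by simp
    qed
    obtain d e where de: "d \<in> A" "d \<noteq> \<zero>\<^bsub>R\<^esub>" "e \<in> R.simple_extension A x" "d = b \<otimes>\<^bsub>R\<^esub> e"
      using R.minimal_annihilator_multiple[OF A x pA a0 p0 min b] by blast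
    show thesis
    proof (rule that[of "a \<otimes>\<^bsub>R\<^esub> d"])
      show "a \<otimes>\<^bsub>R\<^esub> d \<in> A" using subringE(6)[OF A] aR de by blast
      show "a \<otimes>\<^bsub>R\<^esub> d \<noteq> \<zero>\<^bsub>R\<^esub>" using a0 de aR AR R.integral_iff by auto
      fix f assume f: "f \<in> ring_hom (R\<lparr>carrier := A\<rparr>) K" "f (a \<otimes>\<^bsub>R\<^esub> d) \<noteq> \<zero>\<^bsub>K\<^esub>"
      have fc: "f c \<in> carrier K" if "c \<in> A" for c using ring_hom_closed[OF f(1)] that by simp
      have "f (a \<otimes>\<^bsub>R\<^esub> d) = f a \<otimes>\<^bsub>K\<^esub> f d" using ring_hom_mult[OF f(1)] aR de by simp
      then have fad: "f a \<noteq> \<zero>\<^bsub>K\<^esub>" "f d \<noteq> \<zero>\<^bsub>K\<^esub>" using f(2) fc aR de by auto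
      obtain s where s: "s \<in> carrier K" "K.eval (map f (a # hs)) s = \<zero>\<^bsub>K\<^esub>"
      proof (rule K.exists_root)
        show "set (map f (a # hs)) \<subseteq> carrier K" using fK[OF f(1) pA] .
        show "2 \<le> length (map f (a # hs))" using hs by (cases hs) auto
        show "hd (map f (a # hs)) \<noteq> \<zero>\<^bsub>K\<^esub>" using fad by simp
      qed
      have rel: "hom_eval K f s g = \<zero>\<^bsub>K\<^esub>" if g: "set g \<subseteq> A" "R.eval g x = \<zero>\<^bsub>R\<^esub>" for g
      proof (cases "length g \<le> length hs")
        case True
        then have "set g \<subseteq> {\<zero>\<^bsub>R\<^esub>}" using min g by blast
        then have "set (map f g) \<subseteq> {\<zero>\<^bsub>K\<^esub>}" using f0[OF f(1)] by auto
        then show ?thesis unfolding hom_eval_def using K.eval_zeros s by blast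
      next
        case False
        then have len: "length hs < length g" by simp
        have idh: "id \<in> ring_hom (R\<lparr>carrier := A\<rparr>) R"
          using AR by (auto intro!: ring_hom_memI)
        have Ad: "domain (R\<lparr>carrier := A\<rparr>)" by (rule R.subring_is_domain[OF A])
        have idc: "ring_hom_cring (R\<lparr>carrier := A\<rparr>) R id"
          by (intro ring_hom_cring.intro ring_hom_cring_axioms.intro domain.axioms(1)[OF Ad] R.is_cring idh)
        have fcr: "ring_hom_cring (R\<lparr>carrier := A\<rparr>) K f"
          by (rule point_lift.hom_cring_f[OF lift[OF f(1) s(1)]])
        have "a \<in> carrier (R\<lparr>carrier := A\<rparr>)" "a \<noteq> \<zero>\<^bsub>R\<lparr>carrier := A\<rparr>\<^esub>"
          "set hs \<subseteq> carrier (R\<lparr>carrier := A\<rparr>)" "set g \<subseteq> carrier (R\<lparr>carrier := A\<rparr>)"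
          using aR a0 pA g by simp_all
        then show ?thesis
        proof (rule pseudo_division[OF Ad idc fcr x s(1) _ _ _ _ len])
          fix n :: nat and q r
          assume 1: "set q \<subseteq> carrier (R\<lparr>carrier := A\<rparr>)" "set r \<subseteq> carrier (R\<lparr>carrier := A\<rparr>)"
            "length r \<le> length hs"
            and 2: "id (a [^]\<^bsub>R\<lparr>carrier := A\<rparr>\<^esub> n) \<otimes>\<^bsub>R\<^esub> hom_eval R id x g
              = hom_eval R id x q \<otimes>\<^bsub>R\<^esub> hom_eval R id x (a # hs) \<oplus>\<^bsub>R\<^esub> hom_eval R id x r"
            and 3: "f (a [^]\<^bsub>R\<lparr>carrier := A\<rparr>\<^esub> n) \<otimes>\<^bsub>K\<^esub> hom_eval K f s g
              = hom_eval K f s q \<otimes>\<^bsub>K\<^esub> hom_eval K f s (a # hs) \<oplus>\<^bsub>K\<^esub> hom_eval K f s r"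
          have qr: "set q \<subseteq> A" "set r \<subseteq> A" using 1 by simp_all
          have pw: "a [^]\<^bsub>R\<lparr>carrier := A\<rparr>\<^esub> n = a [^]\<^bsub>R\<^esub> n" by (rule R.nat_pow_consistent[symmetric])
          have "a [^]\<^bsub>R\<^esub> n \<otimes>\<^bsub>R\<^esub> R.eval g x = R.eval q x \<otimes>\<^bsub>R\<^esub> R.eval (a # hs) x \<oplus>\<^bsub>R\<^esub> R.eval r x"
            using 2 by (simp only: hom_eval_def list.map_id id_apply pw)
          then have "R.eval r x = \<zero>\<^bsub>R\<^esub>"
            using evR[OF qr(1)] evR[OF qr(2)] aR unfolding g(2) p0 by simp
          then have "set r \<subseteq> {\<zero>\<^bsub>R\<^esub>}" using min qr 1 by blast
          then have "set (map f r) \<subseteq> {\<zero>\<^bsub>K\<^esub>}" using f0[OF f(1)] by auto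
          then have "hom_eval K f s r = \<zero>\<^bsub>K\<^esub>" unfolding hom_eval_def using K.eval_zeros s by blast
          moreover have "hom_eval K f s (a # hs) = \<zero>\<^bsub>K\<^esub>" using s by (simp only: hom_eval_def)
          moreover have ev: "hom_eval K f s q \<in> carrier K" "hom_eval K f s g \<in> carrier K"
            using K.eval_in_carrier[OF fK[OF f(1)] s(1)] qr g by (simp_all add: hom_eval_def)
          ultimately have z: "f (a [^]\<^bsub>R\<^esub> n) \<otimes>\<^bsub>K\<^esub> hom_eval K f s g = \<zero>\<^bsub>K\<^esub>"
            using 3 pw by simp
          have pA: "a [^]\<^bsub>R\<^esub> n \<in> A" for n :: nat
            using aR by (induction n) (auto intro: subringE(3,6)[OF A])
          have "f (a [^]\<^bsub>R\<^esub> n) = f a [^]\<^bsub>K\<^esub> n" for n :: nat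
          proof (induction n)
            case 0
            then show ?case using ring_hom_one[OF f(1)] by simp
          next
            case (Suc n)
            then show ?case using ring_hom_mult[OF f(1), of "a [^]\<^bsub>R\<^esub> n" a] pA aR by simp
          qed
          then have "f (a [^]\<^bsub>R\<^esub> n) \<noteq> \<zero>\<^bsub>K\<^esub>" using K.pow_nonzero[OF fc[OF aR(1)] fad(1)] by simp
          then show ?thesis using z ev fc[OF pA] K.integral by blast
        qed
      qed
      obtain h where h: "h \<in> ring_hom (R\<lparr>carrier := R.simple_extension A x\<rparr>) K"
        "\<And>c. c \<in> A \<Longrightarrow> h c = f c"
        using point_lift.hom_extends[OF lift[OF f(1) s(1)] rel] by metis
      have "h b \<otimes>\<^bsub>K\<^esub> h e = f d"
        using ring_hom_mult[OF h(1), of b e] b de h(2)[OF de(1)] by simp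
      moreover have "h e \<in> carrier K" using ring_hom_closed[OF h(1)] de by simp
      ultimately have "h b \<noteq> \<zero>\<^bsub>K\<^esub>" using fad by auto
      then show "\<exists>h \<in> ring_hom (R\<lparr>carrier := R.simple_extension A x\<rparr>) K.
         (\<forall>c\<in>A. h c = f c) \<and> h b \<noteq> \<zero>\<^bsub>K\<^esub>" using h by blast
    qed
  qed
qed

text \<open>
  Weak Nullstellensatz: the elements $b$ at which the homomorphism must not vanish are pushed down along the
  generators to $K$ itself, where the inverse of the structure map starts the construction.
\<close>
lemma nullstellensatz_hom:
  assumes R: "domain R" and K: "algebraically_closed K" "infinite (carrier K)"
    and i: "i \<in> ring_hom K R" and xs: "set xs \<subseteq> carrier R"
    and gen: "ring.finite_extension R (i ` carrier K) xs = carrier R"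
    and b: "b \<in> carrier R" "b \<noteq> \<zero>\<^bsub>R\<^esub>"
  obtains h where "h \<in> ring_hom R K" "\<And>c. c \<in> carrier K \<Longrightarrow> h (i c) = c" "h b \<noteq> \<zero>\<^bsub>K\<^esub>"
proof -
  interpret R: domain R by fact
  interpret K: algebraically_closed K by fact
  interpret i: ring_hom_ring K R i by (rule ring_hom_ringI2[OF K.ring_axioms R.ring_axioms i])
  let ?A = "i ` carrier K"
  have A: "subring ?A R" using i.img_is_subring[OF K.carrier_is_subring] .
  have inj: "inj_on i (carrier K)"
  proof (rule i.non_trivial_field_hom_imp_inj[OF K.field_axioms])
    have "i \<one>\<^bsub>K\<^esub> \<noteq> \<zero>\<^bsub>R\<^esub>" using i.hom_one R.one_not_zero by simp
    then show "i ` carrier K \<noteq> {\<zero>\<^bsub>R\<^esub>}" using K.one_closed by blast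
  qed
  define f where "f = inv_into (carrier K) i"
  have fi: "f (i c) = c" if "c \<in> carrier K" for c
    unfolding f_def using inv_into_f_f[OF inj that] .
  have f: "f \<in> ring_hom (R\<lparr>carrier := ?A\<rparr>) K"
  proof (rule ring_hom_memI)
    fix y z assume "y \<in> carrier (R\<lparr>carrier := ?A\<rparr>)" "z \<in> carrier (R\<lparr>carrier := ?A\<rparr>)"
    then obtain c d where "c \<in> carrier K" "d \<in> carrier K" "y = i c" "z = i d" by auto
    then show "f (y \<otimes>\<^bsub>R\<lparr>carrier := ?A\<rparr>\<^esub> z) = f y \<otimes>\<^bsub>K\<^esub> f z"
      "f (y \<oplus>\<^bsub>R\<lparr>carrier := ?A\<rparr>\<^esub> z) = f y \<oplus>\<^bsub>K\<^esub> f z"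
      using fi fi[of "c \<otimes>\<^bsub>K\<^esub> d"] fi[of "c \<oplus>\<^bsub>K\<^esub> d"] by simp_all
  next
    show "f \<one>\<^bsub>R\<lparr>carrier := ?A\<rparr>\<^esub> = \<one>\<^bsub>K\<^esub>" using fi[of "\<one>\<^bsub>K\<^esub>"] by simp
  qed (use fi in auto)
  have "subring (R.finite_extension ?A ys) R \<and> (\<forall>b \<in> R.finite_extension ?A ys. b \<noteq> \<zero>\<^bsub>R\<^esub> \<longrightarrow>
      (\<exists>h \<in> ring_hom (R\<lparr>carrier := R.finite_extension ?A ys\<rparr>) K. (\<forall>c\<in>carrier K. h (i c) = c) \<and> h b \<noteq> \<zero>\<^bsub>K\<^esub>))"
    if "set ys \<subseteq> carrier R" for ys
    using that
  proof (induction ys)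
    case Nil
    have "\<exists>h \<in> ring_hom (R\<lparr>carrier := ?A\<rparr>) K. (\<forall>c\<in>carrier K. h (i c) = c) \<and> h b \<noteq> \<zero>\<^bsub>K\<^esub>"
      if "b \<in> ?A" "b \<noteq> \<zero>\<^bsub>R\<^esub>" for b
    proof (rule bexI[OF _ f], intro conjI ballI)
      show "f b \<noteq> \<zero>\<^bsub>K\<^esub>" using that fi by auto
    qed (rule fi)
    then show ?case using A by simp
  next
    case (Cons x ys)
    let ?B = "R.finite_extension ?A ys"
    have x: "x \<in> carrier R" and B: "subring ?B R" using Cons by auto
    have ext: "R.finite_extension ?A (x # ys) = R.simple_extension ?B x" by simp
    have "\<exists>h \<in> ring_hom (R\<lparr>carrier := R.simple_extension ?B x\<rparr>) K.
        (\<forall>c\<in>carrier K. h (i c) = c) \<and> h b \<noteq> \<zero>\<^bsub>K\<^esub>"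
      if b: "b \<in> R.simple_extension ?B x" "b \<noteq> \<zero>\<^bsub>R\<^esub>" for b
    proof (rule extend_hom_to_simple_extension[OF R K B x b])
      fix a assume a: "a \<in> ?B" "a \<noteq> \<zero>\<^bsub>R\<^esub>" and
        ext: "\<And>f. f \<in> ring_hom (R\<lparr>carrier := ?B\<rparr>) K \<Longrightarrow> f a \<noteq> \<zero>\<^bsub>K\<^esub> \<Longrightarrow>
           \<exists>h \<in> ring_hom (R\<lparr>carrier := R.simple_extension ?B x\<rparr>) K. (\<forall>c\<in>?B. h c = f c) \<and> h b \<noteq> \<zero>\<^bsub>K\<^esub>"
      obtain g where g: "g \<in> ring_hom (R\<lparr>carrier := ?B\<rparr>) K" "\<forall>c\<in>carrier K. g (i c) = c" "g a \<noteq> \<zero>\<^bsub>K\<^esub>"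
        using Cons a by auto
      from ext[OF g(1,3)] obtain h where
        h: "h \<in> ring_hom (R\<lparr>carrier := R.simple_extension ?B x\<rparr>) K" "\<forall>c\<in>?B. h c = g c" "h b \<noteq> \<zero>\<^bsub>K\<^esub>"
        by blast
      have "?A \<subseteq> ?B"
        using R.finite_extension_incl[OF subringE(1)[OF A]] Cons.prems by simp
      then have "\<forall>c\<in>carrier K. h (i c) = c" using h(2) g(2) by (metis image_subset_iff)
      then show ?thesis using h by blast
    qed
    then show ?case unfolding ext using R.simple_extension_is_subring[OF B x] by blast
  qed
  from this[OF xs] have "\<exists>h \<in> ring_hom R K. (\<forall>c\<in>carrier K. h (i c) = c) \<and> h b \<noteq> \<zero>\<^bsub>K\<^esub>"
    using b gen by simp
  then show thesis using that by blast
qed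

lemma (in ring_hom_ring) image_finite_extension:
  assumes "A \<subseteq> carrier R" "set xs \<subseteq> carrier R"
  shows "h ` R.finite_extension A xs \<subseteq> S.finite_extension (h ` A) (map h xs)"
  using assms(2)
proof (induction xs)
  case Nil
  then show ?case by simp
next
  case (Cons x xs)
  let ?B = "R.finite_extension A xs"
  have B: "?B \<subseteq> carrier R" "h ` ?B \<subseteq> S.finite_extension (h ` A) (map h xs)" and x: "x \<in> carrier R"
    using Cons R.finite_extension_in_carrier[OF assms(1)] by auto
  have sub: "R.simple_extension ?B x \<subseteq> carrier R" by (rule R.simple_extension_in_carrier[OF B(1) x])
  have "h y \<in> S.simple_extension (S.finite_extension (h ` A) (map h xs)) (h x)"
    if "y \<in> R.simple_extension ?B x" for y
    using that
  proof (induction rule: R.simple_extension.induct)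
    case zero
    then show ?case by (simp add: S.simple_extension.zero)
  next
    case (lin k1 k2)
    have "k1 \<in> carrier R" "k2 \<in> carrier R" using lin sub B by auto
    then show ?case using lin x B S.simple_extension.lin[OF lin.IH, of "h k2"] by auto
  qed
  then show ?case by auto
qed

text \<open>
  For $y$ outside the kernel, surjectivity provides $z$ such that $1 - yz$ is in the kernel.
\<close>
lemma maximalideal_kernel:
  assumes R: "cring R" and K: "field K" and g: "g \<in> ring_hom R K"
    and surj: "g ` carrier R = carrier K"
  shows "maximalideal (a_kernel R K g) R"
proof -
  interpret R: cring R by fact
  interpret K: field K by fact
  interpret g: ring_hom_ring R K g by (rule ring_hom_ringI2[OF R.ring_axioms K.ring_axioms g])
  show ?thesis
  proof (rule maximalidealI[OF g.kernel_is_ideal])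
    show "carrier R \<noteq> a_kernel R K g"
      using g.hom_one K.one_not_zero R.one_closed unfolding a_kernel_def' by force
  next
    fix J assume J: "ideal J R" "a_kernel R K g \<subseteq> J" "J \<subseteq> carrier R"
    interpret J: ideal J R by fact
    show "J = a_kernel R K g \<or> J = carrier R"
    proof (rule disjCI)
      assume "J \<noteq> carrier R"
      show "J = a_kernel R K g"
      proof (rule ccontr)
        assume "J \<noteq> a_kernel R K g"
        then obtain y where y: "y \<in> J" "y \<in> carrier R" "g y \<noteq> \<zero>\<^bsub>K\<^esub>"
          using J unfolding a_kernel_def' by blast
        have "inv\<^bsub>K\<^esub> (g y) \<in> carrier K" "g y \<otimes>\<^bsub>K\<^esub> inv\<^bsub>K\<^esub> (g y) = \<one>\<^bsub>K\<^esub>"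
          using y K.field_Units by (auto simp: K.Units_r_inv)
        then obtain z where z: "z \<in> carrier R" "g y \<otimes>\<^bsub>K\<^esub> g z = \<one>\<^bsub>K\<^esub>" using surj by (metis imageE)
        define w where "w = \<one>\<^bsub>R\<^esub> \<ominus>\<^bsub>R\<^esub> y \<otimes>\<^bsub>R\<^esub> z"
        have w: "w \<in> carrier R" "w \<oplus>\<^bsub>R\<^esub> y \<otimes>\<^bsub>R\<^esub> z = \<one>\<^bsub>R\<^esub>"
          unfolding w_def using y z by (simp_all add: R.minus_eq R.a_assoc R.l_neg)
        then have "g w \<oplus>\<^bsub>K\<^esub> g y \<otimes>\<^bsub>K\<^esub> g z = \<one>\<^bsub>K\<^esub>"
          using y z g.hom_add[of w "y \<otimes>\<^bsub>R\<^esub> z"] g.hom_mult[of y z] g.hom_one by simp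
        then have "g w = \<zero>\<^bsub>K\<^esub>"
          unfolding z(2) using K.add.r_cancel_one'[of "\<one>\<^bsub>K\<^esub>" "g w"] K.add.l_cancel_one'[of "\<one>\<^bsub>K\<^esub>" "g w"]
            g.hom_closed[OF w(1)] by (metis K.one_closed)
        then have "w \<in> J" using J w unfolding a_kernel_def' by blast
        moreover have "y \<otimes>\<^bsub>R\<^esub> z \<in> J" using J.I_r_closed y z by blast
        ultimately have "\<one>\<^bsub>R\<^esub> \<in> J" using J.a_closed w(2) by metis
        then show False using J.one_imp_carrier \<open>J \<noteq> carrier R\<close> by simp
      qed
    qed
  qed
qed

text \<open>
  The quotient by a prime ideal is again a finitely generated algebra and a domain, so its nonzero
  elements can be detected by homomorphisms to $K$. These are surjective, because they restrict to
  the identity on $K$, and their kernels in $R$ are the required maximal ideals.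
\<close>
theorem finitely_generated_algebra_jacobson:
  assumes R: "cring R" and K: "algebraically_closed K" "infinite (carrier K)"
    and i: "i \<in> ring_hom K R" and xs: "set xs \<subseteq> carrier R"
    and gen: "ring.finite_extension R (i ` carrier K) xs = carrier R"
  shows "jacobson_ring R"
  unfolding jacobson_ring_def
proof (intro conjI allI impI R)
  fix P assume P: "primeideal P R"
  interpret R: cring R by fact
  interpret P: primeideal P R by fact
  interpret K: algebraically_closed K by fact
  define Q where "Q = R Quot P"
  interpret Q: domain Q unfolding Q_def by (rule P.quotient_is_domain)
  define \<pi> where "\<pi> = (+>\<^bsub>R\<^esub>) P"
  have pi: "\<pi> \<in> ring_hom R Q" unfolding \<pi>_def Q_def by (rule P.rcos_ring_hom)
  interpret pi: ring_hom_ring R Q \<pi> by (rule ring_hom_ringI2[OF R.ring_axioms Q.ring_axioms pi])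
  have Qc: "carrier Q = \<pi> ` carrier R"
    by (auto simp: Q_def \<pi>_def FactRing_def A_RCOSETS_defs a_r_coset_def)
  have Q0: "\<zero>\<^bsub>Q\<^esub> = P" by (simp add: Q_def FactRing_def)
  have pi0: "\<pi> y = \<zero>\<^bsub>Q\<^esub> \<longleftrightarrow> y \<in> P" if "y \<in> carrier R" for y
    unfolding Q0 \<pi>_def using that P.a_rcos_const R.a_coset_join1 P.is_additive_subgroup
    by (metis P.a_rcos_self)
  have iR: "i ` carrier K \<subseteq> carrier R" using i by (auto simp: ring_hom_def)
  have ii: "\<pi> \<circ> i \<in> ring_hom K Q" by (rule ring_hom_trans[OF i pi])
  have genQ: "Q.finite_extension ((\<pi> \<circ> i) ` carrier K) (map \<pi> xs) = carrier Q"
  proof (rule equalityI)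
    show "carrier Q \<subseteq> Q.finite_extension ((\<pi> \<circ> i) ` carrier K) (map \<pi> xs)"
      using pi.image_finite_extension[OF iR xs] unfolding gen Qc by (simp only: image_comp)
    show "Q.finite_extension ((\<pi> \<circ> i) ` carrier K) (map \<pi> xs) \<subseteq> carrier Q"
      by (rule Q.finite_extension_in_carrier) (use iR xs Qc in auto)
  qed
  have sep: "\<exists>M. maximalideal M R \<and> P \<subseteq> M \<and> b \<notin> M" if b: "b \<in> carrier R" "b \<notin> P" for b
  proof -
    have "\<pi> b \<noteq> \<zero>\<^bsub>Q\<^esub>" "\<pi> b \<in> carrier Q" using pi0 b Qc by auto
    then obtain h where h: "h \<in> ring_hom Q K" "\<And>c. c \<in> carrier K \<Longrightarrow> h ((\<pi> \<circ> i) c) = c" "h (\<pi> b) \<noteq> \<zero>\<^bsub>K\<^esub>"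
      using nullstellensatz_hom[OF Q.domain_axioms K ii _ genQ] xs Qc by (metis image_mono list.set_map)
    let ?M = "a_kernel R K (h \<circ> \<pi>)"
    have hp: "h \<circ> \<pi> \<in> ring_hom R K" by (rule ring_hom_trans[OF pi h(1)])
    have "(h \<circ> \<pi>) ` carrier R = carrier K"
    proof (rule equalityI)
      show "(h \<circ> \<pi>) ` carrier R \<subseteq> carrier K" using hp by (auto simp: ring_hom_def)
      show "carrier K \<subseteq> (h \<circ> \<pi>) ` carrier R"
      proof
        fix c assume "c \<in> carrier K"
        then show "c \<in> (h \<circ> \<pi>) ` carrier R"
          using h(2)[of c] iR by (intro image_eqI[of _ _ "i c"]) auto
      qed
    qed
    then have "maximalideal ?M R" by (rule maximalideal_kernel[OF R K.field_axioms hp])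
    moreover
    have h0: "h \<zero>\<^bsub>Q\<^esub> = \<zero>\<^bsub>K\<^esub>" by (rule ring_hom_zero[OF h(1) Q.ring_axioms K.ring_axioms])
    moreover have "P \<subseteq> ?M"
    proof
      fix y assume "y \<in> P"
      then have "y \<in> carrier R" "\<pi> y = \<zero>\<^bsub>Q\<^esub>" using pi0 P.a_subset by blast+
      with h0 show "y \<in> ?M" unfolding a_kernel_def' by simp
    qed
    moreover have "b \<notin> ?M" unfolding a_kernel_def' using h(3) by simp
    ultimately show ?thesis by blast
  qed
  let ?S = "{M. maximalideal M R \<and> P \<subseteq> M}"
  have ne: "?S \<noteq> {}" using sep P.I_notcarr P.a_subset by blast
  have eq: "P = \<Inter> ?S"
  proof (rule equalityI)
    show "\<Inter> ?S \<subseteq> P"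
    proof
      fix b assume b: "b \<in> \<Inter> ?S"
      obtain M where M: "M \<in> ?S" using ne by blast
      then interpret M: maximalideal M R by simp
      have "M \<subseteq> carrier R" by (rule M.a_subset)
      then have "b \<in> carrier R" using b M by blast
      then show "b \<in> P" using sep b by blast
    qed
  qed blast
  have mx: "\<forall>I\<in>?S. maximalideal I R" by blast
  show "\<exists>S. S \<noteq> {} \<and> (\<forall>I\<in>S. maximalideal I R) \<and> P = \<Inter> S"
    by (intro exI[of _ ?S] conjI ne mx eq)
qed

section \<open>The monoid algebra is a commutative ring\<close>

locale monoid_algebra_setup = K?: cring K + M?: comm_monoid M
  for K :: "('k, 'x) ring_scheme" (structure) and M :: "('m, 'y) monoid_scheme" (structure)
begin

abbreviation "R \<equiv> monoid_algebra K M"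

definition monomial :: "'k \<Rightarrow> 'm \<Rightarrow> 'm \<Rightarrow> 'k" where
  "monomial c a = (\<lambda>x. if x = a then c else \<zero>\<^bsub>K\<^esub>)"

lemma R_simps:
  "f \<oplus>\<^bsub>R\<^esub> g = (\<lambda>x. f x \<oplus>\<^bsub>K\<^esub> g x)" "\<zero>\<^bsub>R\<^esub> = (\<lambda>x. \<zero>\<^bsub>K\<^esub>)" "\<one>\<^bsub>R\<^esub> = monomial \<one>\<^bsub>K\<^esub> \<one>\<^bsub>M\<^esub>"
  by (simp_all add: monoid_algebra_def monomial_def)

lemma carrierD:
  assumes "f \<in> carrier R"
  shows "f x \<in> carrier K" "finite (msupp K f)" "msupp K f \<subseteq> carrier M"
  using assms by (auto simp: monoid_algebra_def)

lemma carrierI: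
  assumes "\<And>x. f x \<in> carrier K" "finite A" "A \<subseteq> carrier M" "msupp K f \<subseteq> A"
  shows "f \<in> carrier R"
  using assms by (auto simp: monoid_algebra_def intro: finite_subset)

lemma monomial_closed: "c \<in> carrier K \<Longrightarrow> a \<in> carrier M \<Longrightarrow> monomial c a \<in> carrier R"
  by (rule carrierI[of _ "{a}"]) (auto simp: monomial_def msupp_def)

lemma msupp_monomial: "msupp K (monomial c a) \<subseteq> {a}"
  by (auto simp: monomial_def msupp_def)

lemma add_closed: "f \<in> carrier R \<Longrightarrow> g \<in> carrier R \<Longrightarrow> f \<oplus>\<^bsub>R\<^esub> g \<in> carrier R"
  by (rule carrierI[of _ "msupp K f \<union> msupp K g"])
    (auto simp: R_simps carrierD dest!: carrierD(2,3), auto simp: msupp_def)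

lemma zero_closed': "\<zero>\<^bsub>R\<^esub> \<in> carrier R"
  by (rule carrierI[of _ "{}"]) (auto simp: R_simps msupp_def)

lemma abelian_group_R: "abelian_group R"
proof (rule abelian_groupI)
  fix f assume f: "f \<in> carrier R"
  have "(\<lambda>x. \<ominus>\<^bsub>K\<^esub> f x) \<in> carrier R"
    by (rule carrierI[of _ "msupp K f"]) (use carrierD[OF f] in \<open>auto simp: msupp_def\<close>)
  moreover have "(\<lambda>x. \<ominus>\<^bsub>K\<^esub> f x) \<oplus>\<^bsub>R\<^esub> f = \<zero>\<^bsub>R\<^esub>"
    using carrierD[OF f] by (simp add: R_simps K.l_neg)
  ultimately show "\<exists>g\<in>carrier R. g \<oplus>\<^bsub>R\<^esub> f = \<zero>\<^bsub>R\<^esub>" by blast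
qed (auto simp: add_closed zero_closed' , auto simp: R_simps carrierD K.a_ac)

text \<open>
  The index set in the definition of the product depends on the two supports. Summing
  over a fixed rectangle containing them makes the product visibly bilinear.
\<close>
lemma mult_expand:
  assumes f: "f \<in> carrier R" and g: "g \<in> carrier R"
    and A: "finite A" "msupp K f \<subseteq> A" and B: "finite B" "msupp K g \<subseteq> B"
  shows "(f \<otimes>\<^bsub>R\<^esub> g) x
    = (\<Oplus>\<^bsub>K\<^esub>p \<in> A \<times> B. if fst p \<otimes>\<^bsub>M\<^esub> snd p = x then f (fst p) \<otimes>\<^bsub>K\<^esub> g (snd p) else \<zero>\<^bsub>K\<^esub>)"
proof -
  have "(f \<otimes>\<^bsub>R\<^esub> g) x = (\<Oplus>\<^bsub>K\<^esub>p \<in> {(a, b). a \<in> msupp K f \<and> b \<in> msupp K g \<and> a \<otimes>\<^bsub>M\<^esub> b = x}.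
                f (fst p) \<otimes>\<^bsub>K\<^esub> g (snd p))"
    by (simp add: monoid_algebra_def)
  also have "\<dots> = (\<Oplus>\<^bsub>K\<^esub>p \<in> A \<times> B. if fst p \<otimes>\<^bsub>M\<^esub> snd p = x then f (fst p) \<otimes>\<^bsub>K\<^esub> g (snd p) else \<zero>\<^bsub>K\<^esub>)"
    by (rule K.add.finprod_mono_neutral_cong_left)
      (use A B carrierD(1)[OF f] carrierD(1)[OF g] in \<open>auto simp: msupp_def\<close>)
  finally show ?thesis .
qed

lemma msupp_mult:
  assumes f: "f \<in> carrier R" and g: "g \<in> carrier R"
  shows "msupp K (f \<otimes>\<^bsub>R\<^esub> g) \<subseteq> {a \<otimes>\<^bsub>M\<^esub> b | a b. a \<in> msupp K f \<and> b \<in> msupp K g}"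
proof
  fix x assume x: "x \<in> msupp K (f \<otimes>\<^bsub>R\<^esub> g)"
  show "x \<in> {a \<otimes>\<^bsub>M\<^esub> b | a b. a \<in> msupp K f \<and> b \<in> msupp K g}"
  proof (rule ccontr)
    assume "x \<notin> {a \<otimes>\<^bsub>M\<^esub> b | a b. a \<in> msupp K f \<and> b \<in> msupp K g}"
    then have "(f \<otimes>\<^bsub>R\<^esub> g) x = \<zero>\<^bsub>K\<^esub>"
      unfolding mult_expand[OF f g carrierD(2)[OF f] order_refl carrierD(2)[OF g] order_refl]
      by (intro K.add.finprod_one_eqI) auto
    then show False using x by (simp add: msupp_def)
  qed
qed

lemma mult_closed:
  assumes f: "f \<in> carrier R" and g: "g \<in> carrier R"
  shows "f \<otimes>\<^bsub>R\<^esub> g \<in> carrier R"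
proof (rule carrierI[OF _ _ _ msupp_mult[OF f g]])
  show "(f \<otimes>\<^bsub>R\<^esub> g) x \<in> carrier K" for x
    unfolding mult_expand[OF f g carrierD(2)[OF f] order_refl carrierD(2)[OF g] order_refl]
    using carrierD(1)[OF f] carrierD(1)[OF g] by (intro K.finsum_closed) auto
  show "finite {a \<otimes>\<^bsub>M\<^esub> b | a b. a \<in> msupp K f \<and> b \<in> msupp K g}"
    by (rule finite_image_set2) (use carrierD(2)[OF f] carrierD(2)[OF g] in auto)
  show "{a \<otimes>\<^bsub>M\<^esub> b | a b. a \<in> msupp K f \<and> b \<in> msupp K g} \<subseteq> carrier M"
    using carrierD(3)[OF f] carrierD(3)[OF g] by (auto intro!: M.m_closed)
qed

lemma mult_comm:
  assumes f: "f \<in> carrier R" and g: "g \<in> carrier R"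
  shows "f \<otimes>\<^bsub>R\<^esub> g = g \<otimes>\<^bsub>R\<^esub> f"
proof
  fix x
  note ex = mult_expand[OF _ _ carrierD(2) order_refl carrierD(2) order_refl]
  let ?F = "\<lambda>p. if fst p \<otimes>\<^bsub>M\<^esub> snd p = x then f (fst p) \<otimes>\<^bsub>K\<^esub> g (snd p) else \<zero>\<^bsub>K\<^esub>"
  have "(f \<otimes>\<^bsub>R\<^esub> g) x = (\<Oplus>\<^bsub>K\<^esub>p \<in> prod.swap ` (msupp K g \<times> msupp K f). ?F p)"
    unfolding ex[OF f g f g] by (simp add: product_swap)
  also have "\<dots> = (\<Oplus>\<^bsub>K\<^esub>p \<in> msupp K g \<times> msupp K f. ?F (prod.swap p))"
    by (rule K.finsum_reindex) (use carrierD(1)[OF f] carrierD(1)[OF g] in auto)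
  also have "\<dots> = (g \<otimes>\<^bsub>R\<^esub> f) x"
    unfolding ex[OF g f g f]
  proof (rule K.add.finprod_cong')
    fix p assume "p \<in> msupp K g \<times> msupp K f"
    then have "fst p \<in> carrier M" "snd p \<in> carrier M"
      using carrierD(3)[OF f] carrierD(3)[OF g] by auto
    then show "?F (prod.swap p)
        = (if fst p \<otimes>\<^bsub>M\<^esub> snd p = x then g (fst p) \<otimes>\<^bsub>K\<^esub> f (snd p) else \<zero>\<^bsub>K\<^esub>)"
      using carrierD(1)[OF f] carrierD(1)[OF g]
      by (simp add: M.m_comm[of "snd p"] K.m_comm[of "f (snd p)"])
  qed (use carrierD(1)[OF f] carrierD(1)[OF g] in auto)
  finally show "(f \<otimes>\<^bsub>R\<^esub> g) x = (g \<otimes>\<^bsub>R\<^esub> f) x" .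
qed

lemma mult_l_distr:
  assumes f: "f \<in> carrier R" and g: "g \<in> carrier R" and h: "h \<in> carrier R"
  shows "(f \<oplus>\<^bsub>R\<^esub> g) \<otimes>\<^bsub>R\<^esub> h = (f \<otimes>\<^bsub>R\<^esub> h) \<oplus>\<^bsub>R\<^esub> (g \<otimes>\<^bsub>R\<^esub> h)"
proof
  fix x
  define A where "A = msupp K f \<union> msupp K g"
  have A: "finite A" "msupp K f \<subseteq> A" "msupp K g \<subseteq> A" "msupp K (f \<oplus>\<^bsub>R\<^esub> g) \<subseteq> A"
    using carrierD(2)[OF f] carrierD(2)[OF g] by (auto simp: A_def R_simps msupp_def)
  note fgh = carrierD(1)[OF f] carrierD(1)[OF g] carrierD(1)[OF h]
  let ?t = "\<lambda>f p. if fst p \<otimes>\<^bsub>M\<^esub> snd p = x then f (fst p) \<otimes>\<^bsub>K\<^esub> h (snd p) else \<zero>\<^bsub>K\<^esub>"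
  have "((f \<oplus>\<^bsub>R\<^esub> g) \<otimes>\<^bsub>R\<^esub> h) x = (\<Oplus>\<^bsub>K\<^esub>p \<in> A \<times> msupp K h. ?t (f \<oplus>\<^bsub>R\<^esub> g) p)"
    by (rule mult_expand[OF add_closed[OF f g] h A(1,4) carrierD(2)[OF h] order_refl])
  also have "\<dots> = (\<Oplus>\<^bsub>K\<^esub>p \<in> A \<times> msupp K h. ?t f p \<oplus>\<^bsub>K\<^esub> ?t g p)"
    by (rule K.add.finprod_cong') (use fgh in \<open>auto simp: R_simps K.l_distr\<close>)
  also have "\<dots> = (\<Oplus>\<^bsub>K\<^esub>p \<in> A \<times> msupp K h. ?t f p) \<oplus>\<^bsub>K\<^esub> (\<Oplus>\<^bsub>K\<^esub>p \<in> A \<times> msupp K h. ?t g p)"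
    by (rule K.finsum_addf) (use fgh in auto)
  also have "\<dots> = ((f \<otimes>\<^bsub>R\<^esub> h) \<oplus>\<^bsub>R\<^esub> (g \<otimes>\<^bsub>R\<^esub> h)) x"
    unfolding R_simps mult_expand[OF f h A(1,2) carrierD(2)[OF h] order_refl]
      mult_expand[OF g h A(1,3) carrierD(2)[OF h] order_refl] ..
  finally show "((f \<oplus>\<^bsub>R\<^esub> g) \<otimes>\<^bsub>R\<^esub> h) x = ((f \<otimes>\<^bsub>R\<^esub> h) \<oplus>\<^bsub>R\<^esub> (g \<otimes>\<^bsub>R\<^esub> h)) x" .
qed

lemma monomial_mult:
  assumes "c \<in> carrier K" "d \<in> carrier K" "a \<in> carrier M" "b \<in> carrier M"
  shows "monomial c a \<otimes>\<^bsub>R\<^esub> monomial d b = monomial (c \<otimes>\<^bsub>K\<^esub> d) (a \<otimes>\<^bsub>M\<^esub> b)"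
proof
  fix x
  have "(monomial c a \<otimes>\<^bsub>R\<^esub> monomial d b) x = (\<Oplus>\<^bsub>K\<^esub>p \<in> {a} \<times> {b}.
      if fst p \<otimes>\<^bsub>M\<^esub> snd p = x then monomial c a (fst p) \<otimes>\<^bsub>K\<^esub> monomial d b (snd p) else \<zero>\<^bsub>K\<^esub>)"
    by (rule mult_expand) (use assms msupp_monomial in \<open>auto intro: monomial_closed\<close>)
  also have "\<dots> = monomial (c \<otimes>\<^bsub>K\<^esub> d) (a \<otimes>\<^bsub>M\<^esub> b) x"
    using assms by (auto simp: monomial_def)
  finally show "(monomial c a \<otimes>\<^bsub>R\<^esub> monomial d b) x = monomial (c \<otimes>\<^bsub>K\<^esub> d) (a \<otimes>\<^bsub>M\<^esub> b) x" .
qed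

text \<open>
  Every element is a sum of monomials; bilinear identities need to be checked on monomials only.
\<close>
lemma monomial_induct [consumes 1, case_names zero add]:
  assumes "f \<in> carrier R"
    and zero: "P \<zero>\<^bsub>R\<^esub>"
    and add: "\<And>c a f. c \<in> carrier K \<Longrightarrow> a \<in> carrier M \<Longrightarrow> f \<in> carrier R \<Longrightarrow> P f \<Longrightarrow> P (monomial c a \<oplus>\<^bsub>R\<^esub> f)"
  shows "P f"
  using assms(1)
proof (induction "card (msupp K f)" arbitrary: f)
  case 0
  then have "msupp K f = {}" using carrierD(2) by auto
  then have "f = \<zero>\<^bsub>R\<^esub>" by (auto simp: msupp_def R_simps)
  then show ?case using zero by simp
next
  case (Suc n)
  then obtain a where a: "a \<in> msupp K f" by (metis card.empty ex_in_conv old.nat.distinct(2))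
  have f: "f \<in> carrier R" by fact
  define g where "g = (\<lambda>x. if x = a then \<zero>\<^bsub>K\<^esub> else f x)"
  have supp: "msupp K g = msupp K f - {a}" by (auto simp: g_def msupp_def)
  have g: "g \<in> carrier R"
    by (rule carrierI[of _ "msupp K f"]) (use carrierD[OF f] supp in \<open>auto simp: g_def\<close>)
  have "n = card (msupp K g)" using Suc(2) a supp carrierD(2)[OF f] by simp
  from Suc(1)[OF this g] have "P g" .
  moreover have "f = monomial (f a) a \<oplus>\<^bsub>R\<^esub> g"
    using carrierD(1)[OF f] by (auto simp: R_simps monomial_def g_def)
  ultimately show ?case using add[of "f a" a g] carrierD[OF f] a g by auto
qed

lemma mult_assoc:
  assumes f: "f \<in> carrier R" and g: "g \<in> carrier R" and h: "h \<in> carrier R"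
  shows "f \<otimes>\<^bsub>R\<^esub> g \<otimes>\<^bsub>R\<^esub> h = f \<otimes>\<^bsub>R\<^esub> (g \<otimes>\<^bsub>R\<^esub> h)"
proof -
  interpret A: abelian_group R by (rule abelian_group_R)
  have r_distr: "p \<otimes>\<^bsub>R\<^esub> (q \<oplus>\<^bsub>R\<^esub> r) = (p \<otimes>\<^bsub>R\<^esub> q) \<oplus>\<^bsub>R\<^esub> (p \<otimes>\<^bsub>R\<^esub> r)"
    if "p \<in> carrier R" "q \<in> carrier R" "r \<in> carrier R" for p q r
    using that mult_l_distr[of q r p] by (simp add: mult_comm add_closed mult_closed)
  have l_null: "\<zero>\<^bsub>R\<^esub> \<otimes>\<^bsub>R\<^esub> p = \<zero>\<^bsub>R\<^esub>" if "p \<in> carrier R" for p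
    using mult_l_distr[of "\<zero>\<^bsub>R\<^esub>" "\<zero>\<^bsub>R\<^esub>" p] that mult_closed[of "\<zero>\<^bsub>R\<^esub>" p]
    by (metis A.add.r_cancel_one' A.r_zero zero_closed')
  have r_null: "p \<otimes>\<^bsub>R\<^esub> \<zero>\<^bsub>R\<^esub> = \<zero>\<^bsub>R\<^esub>" if "p \<in> carrier R" for p
    using l_null that mult_comm zero_closed' by metis
  note [simp] = mult_l_distr r_distr l_null r_null mult_closed add_closed zero_closed' monomial_closed
  show ?thesis using f
  proof (induction rule: monomial_induct)
    case (add c a f)
    have "monomial c a \<otimes>\<^bsub>R\<^esub> g \<otimes>\<^bsub>R\<^esub> h = monomial c a \<otimes>\<^bsub>R\<^esub> (g \<otimes>\<^bsub>R\<^esub> h)" using g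
    proof (induction rule: monomial_induct)
      case (add d b g)
      have "monomial c a \<otimes>\<^bsub>R\<^esub> monomial d b \<otimes>\<^bsub>R\<^esub> h = monomial c a \<otimes>\<^bsub>R\<^esub> (monomial d b \<otimes>\<^bsub>R\<^esub> h)" using h
      proof (induction rule: monomial_induct)
        case (add e x h)
        then show ?case
          using \<open>c \<in> _\<close> \<open>a \<in> _\<close> \<open>d \<in> _\<close> \<open>b \<in> _\<close>
          by (simp add: monomial_mult K.m_assoc M.m_assoc)
      qed (use add \<open>c \<in> _\<close> \<open>a \<in> _\<close> in simp)
      then show ?case using add h \<open>c \<in> _\<close> \<open>a \<in> _\<close> by simp
    qed (use add h in simp)
    then show ?case using add g h by simp
  qed (use g h in simp)
qed

lemma mult_one:
  assumes f: "f \<in> carrier R"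
  shows "\<one>\<^bsub>R\<^esub> \<otimes>\<^bsub>R\<^esub> f = f"
proof -
  have one: "\<one>\<^bsub>R\<^esub> \<in> carrier R" by (simp add: R_simps monomial_closed)
  interpret A: abelian_group R by (rule abelian_group_R)
  show ?thesis using f
  proof (induction rule: monomial_induct)
    case zero
    have "\<one>\<^bsub>R\<^esub> \<otimes>\<^bsub>R\<^esub> \<zero>\<^bsub>R\<^esub> = \<zero>\<^bsub>R\<^esub> \<otimes>\<^bsub>R\<^esub> \<one>\<^bsub>R\<^esub>" using mult_comm one zero_closed' by blast
    then show ?case using mult_l_distr[of "\<zero>\<^bsub>R\<^esub>" "\<zero>\<^bsub>R\<^esub>" "\<one>\<^bsub>R\<^esub>"] one mult_closed[of "\<zero>\<^bsub>R\<^esub>" "\<one>\<^bsub>R\<^esub>"]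
      by (metis A.add.r_cancel_one' A.r_zero zero_closed')
  next
    case (add c a f)
    have "\<one>\<^bsub>R\<^esub> \<otimes>\<^bsub>R\<^esub> monomial c a = monomial c a"
      using add by (simp add: R_simps(3) monomial_mult)
    then show ?case
      using add one mult_l_distr[of "monomial c a" f "\<one>\<^bsub>R\<^esub>"]
      by (simp add: mult_comm[of "\<one>\<^bsub>R\<^esub>"] add_closed monomial_closed)
  qed
qed

theorem monoid_algebra_cring: "cring R"
proof (rule cringI[OF abelian_group_R])
  have "\<one>\<^bsub>R\<^esub> \<in> carrier R" by (simp add: R_simps(3) monomial_closed)
  then show "comm_monoid R"
    by (intro comm_monoidI) (auto simp: mult_closed mult_assoc mult_one intro: mult_comm)
qed (rule mult_l_distr)

lemma const_ring_hom: "(\<lambda>c. monomial c \<one>\<^bsub>M\<^esub>) \<in> ring_hom K R"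
  by (rule ring_hom_memI) (auto simp: monomial_closed monomial_mult R_simps, auto simp: monomial_def)

end

section \<open>Saturated monoids\<close>

text \<open>
  Dickson's lemma in the finite-basis form, by induction on the number of coordinates. A basis $B$
  for the smaller set of coordinates still works for the elements whose new coordinate $w$ is at
  least $N$, the maximum of $w$ on $B$; each of the finitely many values of $w$ below $N$ gets a
  basis of its own.
\<close>
lemma dickson:
  fixes U :: "('a \<Rightarrow> nat) set"
  assumes "finite U"
  shows "\<exists>B\<subseteq>S. finite B \<and> (\<forall>s\<in>S. \<exists>b\<in>B. \<forall>u\<in>U. u b \<le> u s)"
  using assms
proof (induction U arbitrary: S rule: finite_induct)
  case empty
  show ?case
  proof (cases "S = {}")
    case False
    then obtain s where "s \<in> S" by blast
    then show ?thesis by (intro exI[of _ "{s}"]) auto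
  qed simp
next
  case (insert w U)
  obtain B where B: "B \<subseteq> S" "finite B" "\<forall>s\<in>S. \<exists>b\<in>B. \<forall>u\<in>U. u b \<le> u s"
    using insert.IH by blast
  define N where "N = Max (insert 0 (w ` B))"
  have N: "w b \<le> N" if "b \<in> B" for b
    unfolding N_def using that B(2) by (intro Max_ge) auto
  have "\<forall>k. \<exists>C. C \<subseteq> {s\<in>S. w s = k} \<and> finite C \<and> (\<forall>s\<in>{s\<in>S. w s = k}. \<exists>b\<in>C. \<forall>u\<in>U. u b \<le> u s)"
    using insert.IH by (intro allI) blast
  from choice[OF this] obtain C where C0: "\<forall>k. C k \<subseteq> {s\<in>S. w s = k} \<and> finite (C k)
      \<and> (\<forall>s\<in>{s\<in>S. w s = k}. \<exists>b\<in>C k. \<forall>u\<in>U. u b \<le> u s)" ..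
  then have C: "\<And>k. C k \<subseteq> {s\<in>S. w s = k}" "\<And>k. finite (C k)"
    "\<And>k s. s \<in> S \<Longrightarrow> w s = k \<Longrightarrow> \<exists>b\<in>C k. \<forall>u\<in>U. u b \<le> u s"
    by blast+
  let ?B = "B \<union> (\<Union>k<N. C k)"
  have "\<exists>b\<in>?B. \<forall>u\<in>insert w U. u b \<le> u s" if s: "s \<in> S" for s
  proof (cases "w s < N")
    case True
    obtain b where b: "b \<in> C (w s)" "\<forall>u\<in>U. u b \<le> u s" using C(3)[OF s refl] by blast
    moreover have "w b = w s" using C(1)[of "w s"] b by auto
    ultimately show ?thesis using True by (intro bexI[of _ b]) auto
  next
    case False
    obtain b where b: "b \<in> B" "\<forall>u\<in>U. u b \<le> u s" using B(3) s by blast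
    then show ?thesis using N[OF b(1)] False by (intro bexI[of _ b]) auto
  qed
  moreover have "?B \<subseteq> S" using B(1) C(1) by blast
  moreover have "finite ?B" using B(2) C(2) by simp
  ultimately show ?case by (intro exI[of _ ?B]) blast
qed

lemma measures_trans: "(a, b) \<in> measures us \<Longrightarrow> (b, c) \<in> measures us \<Longrightarrow> (a, c) \<in> measures us"
  by (induction us) auto

lemma measures_irrefl: "(a, a) \<notin> measures us"
  by (induction us) auto

lemma measures_total:
  "(a, b) \<in> measures us \<or> (b, a) \<in> measures us \<or> (\<forall>u\<in>set us. u a = u b)"
  by (induction us) auto

text \<open>
  Translating by $t$ does not change the lexicographic order of coordinate vectors.
\<close>
lemma measures_translate:
  assumes "\<And>u. u \<in> set us \<Longrightarrow> u a' = u a + u t" "\<And>u. u \<in> set us \<Longrightarrow> u b' = u b + u t"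
  shows "(a', b') \<in> measures us \<longleftrightarrow> (a, b) \<in> measures us"
  using assms
proof (induction us)
  case (Cons u us)
  have "u a' = u a + u t" "u b' = u b + u t" using Cons.prems[of u] by auto
  then have "u a' < u b' \<longleftrightarrow> u a < u b" "u a' = u b' \<longleftrightarrow> u a = u b" by simp_all
  then show ?case using Cons by simp
qed simp

text \<open>
  A monoid embedded by \<open>us\<close> into a power of the natural numbers in such a way that its
  divisibility is the componentwise order. Lattice points of a rational cone have this
  property when the slacks of the defining inequalities are added to the coordinates.
  The coordinates form a list because \<^const>\<open>measures\<close> compares them lexicographically in that order.
\<close>

locale saturated_monoid = comm_monoid M for M :: "('m, 'y) monoid_scheme" (structure) +
  fixes us :: "('m \<Rightarrow> nat) list"
  assumes additive: "u \<in> set us \<Longrightarrow> a \<in> carrier M \<Longrightarrow> b \<in> carrier M \<Longrightarrow> u (a \<otimes> b) = u a + u b"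
    and separating: "a \<in> carrier M \<Longrightarrow> b \<in> carrier M \<Longrightarrow> (\<And>u. u \<in> set us \<Longrightarrow> u a = u b) \<Longrightarrow> a = b"
    and divisible: "a \<in> carrier M \<Longrightarrow> b \<in> carrier M \<Longrightarrow> (\<And>u. u \<in> set us \<Longrightarrow> u a \<le> u b)
      \<Longrightarrow> \<exists>c\<in>carrier M. b = a \<otimes> c"
begin

abbreviation less (infix "\<prec>\<^sub>M" 50) where "a \<prec>\<^sub>M b \<equiv> (a, b) \<in> measures us"

lemma total: "a \<in> carrier M \<Longrightarrow> b \<in> carrier M \<Longrightarrow> a \<prec>\<^sub>M b \<or> b \<prec>\<^sub>M a \<or> a = b"
  using measures_total[of a b us] separating by blast

lemma less_mult: 
  assumes "a \<in> carrier M" "b \<in> carrier M" "t \<in> carrier M"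
  shows "a \<otimes> t \<prec>\<^sub>M b \<otimes> t \<longleftrightarrow> a \<prec>\<^sub>M b" "t \<otimes> a \<prec>\<^sub>M t \<otimes> b \<longleftrightarrow> a \<prec>\<^sub>M b"
  using assms by (auto intro!: measures_translate simp: additive)

text \<open>
  A Dickson basis of the elements other than the unit generates: dividing by a basis element
  strictly decreases an element in the well-founded order. Generation is stated as an induction principle.
\<close>
lemma generated_by_finite_set:
  obtains B where "finite B" "B \<subseteq> carrier M"
    "\<And>N. \<one> \<in> N \<Longrightarrow> (\<And>a b. b \<in> B \<Longrightarrow> a \<in> N \<Longrightarrow> b \<otimes> a \<in> N) \<Longrightarrow> carrier M \<subseteq> N"
proof -
  obtain B where B: "B \<subseteq> carrier M - {\<one>}" "finite B"
    "\<forall>s\<in>carrier M - {\<one>}. \<exists>b\<in>B. \<forall>u\<in>set us. u b \<le> u s"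
    using dickson[OF List.finite_set[of us], of "carrier M - {\<one>}"] by auto
  show thesis
  proof (rule that[of B])
    fix N assume one: "\<one> \<in> N" and step: "\<And>a b. b \<in> B \<Longrightarrow> a \<in> N \<Longrightarrow> b \<otimes> a \<in> N"
    have "a \<in> N" if "a \<in> carrier M" for a
      using wf_measures[of us] that
    proof (induction a rule: wf_induct_rule)
      case (less a)
      show ?case
      proof (cases "a = \<one>")
        case False
        then obtain b where b: "b \<in> B" "\<forall>u\<in>set us. u b \<le> u a" using B less.prems by blast
        have bM: "b \<in> carrier M" "b \<noteq> \<one>" using b B by auto
        obtain c where c: "c \<in> carrier M" "a = b \<otimes> c" using divisible[OF bM(1) less.prems] b by blast
        \<comment> \<open>All coordinates of the unit vanish, so nothing lies below it.\<close>
        have "\<not> b \<prec>\<^sub>M \<one>"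
        proof -
          have u0: "u \<one> = 0" if "u \<in> set us" for u using additive[OF that one_closed one_closed] by simp
          have "\<not> (\<exists>u\<in>set us. u b < u \<one>)" using u0 by (metis not_less0)
          moreover have "\<exists>u\<in>set vs. u b < u \<one>" if "(b, \<one>) \<in> measures vs" for vs
            using that by (induction vs) auto
          ultimately show ?thesis by blast
        qed
        then have "\<one> \<prec>\<^sub>M b" using total[of b \<one>] bM by auto
        then have "c \<prec>\<^sub>M a" using less_mult(1)[of \<one> b c] c bM by simp
        then have "c \<in> N" using less.IH c by blast
        then show ?thesis using step[OF b(1)] c by blast
      qed (use one in simp)
    qed
    then show "carrier M \<subseteq> N" by blast
  qed (use B in auto)
qed

end

section \<open>Leading terms\<close>

locale saturated_monoid_algebra = K?: field K + saturated_monoid M us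
  for K :: "('k, 'x) ring_scheme" (structure) and M :: "('m, 'y) monoid_scheme" (structure) and us
begin

sublocale monoid_algebra_setup K M ..

sublocale R: cring R by (rule monoid_algebra_cring)

definition is_lead :: "('m \<Rightarrow> 'k) \<Rightarrow> 'm \<Rightarrow> bool" where
  "is_lead f a \<longleftrightarrow> a \<in> msupp K f \<and> (\<forall>b\<in>msupp K f. b \<noteq> a \<longrightarrow> b \<prec>\<^sub>M a)"

lemma lead_exists:
  assumes f: "f \<in> carrier R" "f \<noteq> \<zero>\<^bsub>R\<^esub>"
  obtains a where "is_lead f a"
proof -
  have "\<exists>a\<in>A. \<forall>b\<in>A. b \<noteq> a \<longrightarrow> b \<prec>\<^sub>M a" if "finite A" "A \<noteq> {}" "A \<subseteq> carrier M" for A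
    using that
  proof (induction A rule: finite_ne_induct)
    case (insert x A)
    then obtain a where a: "a \<in> A" "\<forall>b\<in>A. b \<noteq> a \<longrightarrow> b \<prec>\<^sub>M a" by auto
    have "x \<noteq> a" using a insert by auto
    then have "x \<prec>\<^sub>M a \<or> a \<prec>\<^sub>M x" using total[of x a] a insert by auto
    then show ?case
    proof
      assume "x \<prec>\<^sub>M a"
      then show ?thesis using a by (intro bexI[of _ a]) auto
    next
      assume ax: "a \<prec>\<^sub>M x"
      have "b \<prec>\<^sub>M x" if "b \<in> A" for b
        using a that ax measures_trans[of b a us x] by (cases "b = a") auto
      then show ?thesis by (intro bexI[of _ x]) auto
    qed
  qed auto
  moreover have "msupp K f \<noteq> {}" using f(2) by (auto simp: msupp_def R_simps)
  ultimately show thesis using carrierD[OF f(1)] that unfolding is_lead_def by blast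
qed

lemma lead_in_carrier: "f \<in> carrier R \<Longrightarrow> is_lead f a \<Longrightarrow> a \<in> carrier M"
  using carrierD(3) by (auto simp: is_lead_def)

lemma lead_coeff_nonzero: "is_lead f a \<Longrightarrow> f a \<noteq> \<zero>\<^bsub>K\<^esub>"
  by (simp add: is_lead_def msupp_def)

text \<open>
  The product is strictly monotone in both arguments, so every other pair of support elements
  has a strictly smaller product: the coefficient at the product of the two leading monomials comes
  from one pair only.
\<close>
lemma lead_mult:
  assumes f: "f \<in> carrier R" "is_lead f a" and g: "g \<in> carrier R" "is_lead g b"
  shows "(f \<otimes>\<^bsub>R\<^esub> g) (a \<otimes>\<^bsub>M\<^esub> b) = f a \<otimes>\<^bsub>K\<^esub> g b" and "is_lead (f \<otimes>\<^bsub>R\<^esub> g) (a \<otimes>\<^bsub>M\<^esub> b)"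
proof -
  have aM: "a \<in> carrier M" and bM: "b \<in> carrier M"
    using lead_in_carrier f g by blast+
  note fM = carrierD(3)[OF f(1)] and gM = carrierD(3)[OF g(1)]
  note fK = carrierD(1)[OF f(1)] and gK = carrierD(1)[OF g(1)]
  have below: "a' \<otimes>\<^bsub>M\<^esub> b' \<prec>\<^sub>M a \<otimes>\<^bsub>M\<^esub> b"
    if ab: "a' \<in> msupp K f" "b' \<in> msupp K g" "(a', b') \<noteq> (a, b)" for a' b'
  proof -
    have M: "a' \<in> carrier M" "b' \<in> carrier M" using ab fM gM by auto
    have 1: "a' = a \<or> a' \<prec>\<^sub>M a" "b' = b \<or> b' \<prec>\<^sub>M b" using ab f g by (auto simp: is_lead_def)
    have "a' \<otimes>\<^bsub>M\<^esub> b' = a \<otimes>\<^bsub>M\<^esub> b' \<or> a' \<otimes>\<^bsub>M\<^esub> b' \<prec>\<^sub>M a \<otimes>\<^bsub>M\<^esub> b'"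
      using 1 less_mult(1)[OF M(1) aM M(2)] by auto
    moreover have "a \<otimes>\<^bsub>M\<^esub> b' = a \<otimes>\<^bsub>M\<^esub> b \<or> a \<otimes>\<^bsub>M\<^esub> b' \<prec>\<^sub>M a \<otimes>\<^bsub>M\<^esub> b"
      using 1 less_mult(2)[OF M(2) bM aM] by auto
    moreover have "a' \<otimes>\<^bsub>M\<^esub> b' \<prec>\<^sub>M a \<otimes>\<^bsub>M\<^esub> b' \<or> a \<otimes>\<^bsub>M\<^esub> b' \<prec>\<^sub>M a \<otimes>\<^bsub>M\<^esub> b"
      using 1 ab(3) less_mult(1)[OF M(1) aM M(2)] less_mult(2)[OF M(2) bM aM] by auto
    ultimately show ?thesis using measures_trans[of _ _ us] by auto
  qed
  have ab: "a \<in> msupp K f" "b \<in> msupp K g" using f g by (auto simp: is_lead_def)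
  have "{(a', b'). a' \<in> msupp K f \<and> b' \<in> msupp K g \<and> a' \<otimes>\<^bsub>M\<^esub> b' = a \<otimes>\<^bsub>M\<^esub> b} = {(a, b)}"
    using below measures_irrefl[of "a \<otimes>\<^bsub>M\<^esub> b" us] ab by fastforce
  then show eq: "(f \<otimes>\<^bsub>R\<^esub> g) (a \<otimes>\<^bsub>M\<^esub> b) = f a \<otimes>\<^bsub>K\<^esub> g b"
    using fK gK by (simp add: monoid_algebra_def)
  have "f a \<otimes>\<^bsub>K\<^esub> g b \<noteq> \<zero>\<^bsub>K\<^esub>"
    using lead_coeff_nonzero f g fK gK K.integral_iff by blast
  then have "a \<otimes>\<^bsub>M\<^esub> b \<in> msupp K (f \<otimes>\<^bsub>R\<^esub> g)" using eq by (simp add: msupp_def)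
  moreover have "x \<prec>\<^sub>M a \<otimes>\<^bsub>M\<^esub> b" if x: "x \<in> msupp K (f \<otimes>\<^bsub>R\<^esub> g)" "x \<noteq> a \<otimes>\<^bsub>M\<^esub> b" for x
  proof -
    obtain a' b' where "a' \<in> msupp K f" "b' \<in> msupp K g" "a' \<otimes>\<^bsub>M\<^esub> b' = x"
      using msupp_mult[OF f(1) g(1)] x(1) by blast
    then show ?thesis using below[of a' b'] x(2) by auto
  qed
  ultimately show "is_lead (f \<otimes>\<^bsub>R\<^esub> g) (a \<otimes>\<^bsub>M\<^esub> b)" by (simp add: is_lead_def)
qed

theorem monoid_algebra_domain: "domain R"
proof (rule domain.intro[OF monoid_algebra_cring], rule domain_axioms.intro)
  have "\<one>\<^bsub>R\<^esub> \<one>\<^bsub>M\<^esub> = \<one>\<^bsub>K\<^esub>" "\<zero>\<^bsub>R\<^esub> \<one>\<^bsub>M\<^esub> = \<zero>\<^bsub>K\<^esub>" by (simp_all add: R_simps monomial_def)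
  then show "\<one>\<^bsub>R\<^esub> \<noteq> \<zero>\<^bsub>R\<^esub>" using K.one_not_zero by metis
next
  fix f g assume fg: "f \<otimes>\<^bsub>R\<^esub> g = \<zero>\<^bsub>R\<^esub>" "f \<in> carrier R" "g \<in> carrier R"
  show "f = \<zero>\<^bsub>R\<^esub> \<or> g = \<zero>\<^bsub>R\<^esub>"
  proof (rule ccontr)
    assume "\<not> (f = \<zero>\<^bsub>R\<^esub> \<or> g = \<zero>\<^bsub>R\<^esub>)"
    then obtain a b where "is_lead f a" "is_lead g b" using lead_exists fg by metis
    then have "is_lead (\<zero>\<^bsub>R\<^esub>) (a \<otimes>\<^bsub>M\<^esub> b)" using lead_mult(2) fg by metis
    then show False by (simp add: is_lead_def msupp_def R_simps)
  qed
qed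

text \<open>
  Groebner basis argument: a Dickson basis of the set of leading monomials of $I$ is lifted to
  elements of $I$, and these generate $I$ because subtracting a suitable multiple of one of them
  cancels the leading term of any given element of $I$.
\<close>
theorem monoid_algebra_noetherian: "noetherian_ring R"
proof (rule noetherian_ring.intro[OF R.ring_axioms], rule noetherian_ring_axioms.intro)
  fix I assume I: "ideal I R"
  interpret I: ideal I R by fact
  define S where "S = {a. \<exists>f\<in>I. is_lead f a}"
  obtain B where B: "B \<subseteq> S" "finite B" "\<forall>s\<in>S. \<exists>b\<in>B. \<forall>u\<in>set us. u b \<le> u s"
    using dickson[of "set us" S] by blast
  have "\<forall>b\<in>B. \<exists>f. f \<in> I \<and> is_lead f b" using B(1) unfolding S_def by blast
  then obtain F where F: "\<And>b. b \<in> B \<Longrightarrow> F b \<in> I" "\<And>b. b \<in> B \<Longrightarrow> is_lead (F b) b" by metis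
  have FI: "F ` B \<subseteq> I" using F by auto
  have IR: "I \<subseteq> carrier R" by (rule I.a_subset)
  let ?J = "Idl\<^bsub>R\<^esub> (F ` B)"
  have FR: "F ` B \<subseteq> carrier R" using FI IR by blast
  interpret J: ideal ?J R by (rule R.genideal_ideal[OF FR])
  have lead: "g \<in> ?J" if "g \<in> I" "is_lead g a" for g a
    using wf_measures[of us] that
  proof (induction a arbitrary: g rule: wf_induct_rule)
    case (less a)
    have g: "g \<in> carrier R" using less IR by blast
    have aM: "a \<in> carrier M" using lead_in_carrier[OF g] less by blast
    have "a \<in> S" using less.prems unfolding S_def by blast
    then obtain b where b: "b \<in> B" "\<forall>u\<in>set us. u b \<le> u a" using B(3) by blast
    define f where "f = F b"
    have f: "f \<in> I" "is_lead f b" "f \<in> carrier R" unfolding f_def using F[OF b(1)] IR by auto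
    have bM: "b \<in> carrier M" using lead_in_carrier f by blast
    obtain t where t: "t \<in> carrier M" "a = b \<otimes>\<^bsub>M\<^esub> t" using divisible[OF bM aM] b by blast
    have fb: "f b \<in> Units K" using lead_coeff_nonzero[OF f(2)] carrierD(1)[OF f(3)] by (simp add: K.field_Units)
    have ga: "g a \<in> carrier K" "g a \<noteq> \<zero>\<^bsub>K\<^esub>" using carrierD(1)[OF g] lead_coeff_nonzero less.prems by auto
    define c where "c = inv\<^bsub>K\<^esub> (f b) \<otimes>\<^bsub>K\<^esub> g a"
    have c: "c \<in> carrier K" "f b \<otimes>\<^bsub>K\<^esub> c = g a" "c \<noteq> \<zero>\<^bsub>K\<^esub>"
    proof -
      show cK: "c \<in> carrier K" using fb ga by (simp add: c_def)
      show eq: "f b \<otimes>\<^bsub>K\<^esub> c = g a"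
        unfolding c_def using fb ga by (simp add: K.m_assoc[symmetric] K.Units_closed)
      show "c \<noteq> \<zero>\<^bsub>K\<^esub>" using eq ga fb by auto
    qed
    define p where "p = f \<otimes>\<^bsub>R\<^esub> monomial c t"
    have ct: "monomial c t \<in> carrier R" "is_lead (monomial c t) t"
      using c t by (auto intro: monomial_closed, auto simp: is_lead_def msupp_def monomial_def)
    have p: "p \<in> carrier R" "p \<in> I" "p \<in> ?J"
      unfolding p_def using f ct I.I_r_closed J.I_r_closed R.genideal_self[OF FR] b
      by (auto simp: f_def)
    have pl: "is_lead p a" "p a = g a"
      using lead_mult[OF f(3,2) ct] c unfolding p_def t(2)[symmetric] by (simp_all add: monomial_def)
    define q where "q = g \<ominus>\<^bsub>R\<^esub> p"
    have gqp: "g = q \<oplus>\<^bsub>R\<^esub> p" unfolding q_def using g p by (simp add: R.minus_eq R.a_assoc R.l_neg)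
    have q: "q \<in> carrier R" "q \<in> I"
      unfolding q_def using g p less.prems I.a_closed I.a_inv_closed by (auto simp: R.minus_eq)
    have qx: "q x \<oplus>\<^bsub>K\<^esub> p x = g x" for x using gqp by (metis R_simps(1))
    have "q \<in> ?J"
    proof (cases "q = \<zero>\<^bsub>R\<^esub>")
      case True
      then show ?thesis using J.zero_closed by simp
    next
      case False
      then obtain a' where a': "is_lead q a'" using lead_exists q by blast
      have "a' \<prec>\<^sub>M a"
      proof -
        have q0: "q a' \<noteq> \<zero>\<^bsub>K\<^esub>" using lead_coeff_nonzero[OF a'] .
        have "a' \<noteq> a"
        proof
          assume "a' = a"
          then have "q a' \<oplus>\<^bsub>K\<^esub> p a' = p a'" using qx[of a'] pl(2) by simp
          then show False
            using q0 carrierD(1)[OF q(1), of a'] carrierD(1)[OF p(1), of a'] by (simp add: K.add.r_cancel_one)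
        qed
        moreover have "a' \<in> msupp K g \<union> msupp K p"
        proof (rule ccontr)
          assume "a' \<notin> msupp K g \<union> msupp K p"
          then have "q a' \<oplus>\<^bsub>K\<^esub> \<zero>\<^bsub>K\<^esub> = \<zero>\<^bsub>K\<^esub>" using qx[of a'] by (simp add: msupp_def)
          then show False using q0 carrierD(1)[OF q(1), of a'] by simp
        qed
        ultimately show ?thesis using pl(1) less.prems(2) by (auto simp: is_lead_def)
      qed
      then show ?thesis using less.IH q a' by blast
    qed
    then show ?case using gqp p J.a_closed by simp
  qed
  have "I \<subseteq> ?J"
  proof
    fix g assume g: "g \<in> I"
    show "g \<in> ?J"
    proof (cases "g = \<zero>\<^bsub>R\<^esub>")
      case True
      then show ?thesis using J.zero_closed by simp
    next
      case False
      then obtain a where "is_lead g a" using lead_exists g IR by blast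
      then show ?thesis by (rule lead[OF g])
    qed
  qed
  then have "I = ?J" using R.genideal_minimal[OF I FI] by (rule equalityI)
  then show "\<exists>A\<subseteq>carrier R. finite A \<and> I = Idl\<^bsub>R\<^esub> A" using FR B(2) by blast
qed

text \<open>
  The constants and the monomials of a finite generating set of the monoid generate all monomials
  and hence everything.
\<close>
theorem monoid_algebra_finitely_generated:
  obtains xs where "set xs \<subseteq> carrier R"
    "ring.finite_extension R ((\<lambda>c. monomial c \<one>\<^bsub>M\<^esub>) ` carrier K) xs = carrier R"
proof -
  interpret R: domain R by (rule monoid_algebra_domain)
  interpret i: ring_hom_ring K R "\<lambda>c. monomial c \<one>\<^bsub>M\<^esub>"
    by (rule ring_hom_ringI2[OF K.ring_axioms R.ring_axioms const_ring_hom])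
  let ?A = "(\<lambda>c. monomial c \<one>\<^bsub>M\<^esub>) ` carrier K"
  have A: "subring ?A R" using i.img_is_subring[OF K.carrier_is_subring] .
  obtain B where B: "finite B" "B \<subseteq> carrier M" and gen:
    "\<And>N. \<one>\<^bsub>M\<^esub> \<in> N \<Longrightarrow> (\<And>a b. b \<in> B \<Longrightarrow> a \<in> N \<Longrightarrow> b \<otimes>\<^bsub>M\<^esub> a \<in> N) \<Longrightarrow> carrier M \<subseteq> N"
    using generated_by_finite_set by blast
  obtain bs where bs: "set bs = B" using B(1) finite_list by blast
  let ?xs = "map (monomial \<one>\<^bsub>K\<^esub>) bs"
  have xs: "set ?xs \<subseteq> carrier R" using B bs by (auto intro: monomial_closed)
  define E where "E = R.finite_extension ?A ?xs"
  have E: "subring E R" unfolding E_def by (rule R.finite_extension_is_subring[OF A xs])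
  have AE: "?A \<subseteq> E" unfolding E_def by (rule R.finite_extension_incl[OF subringE(1)[OF A] xs])
  have BE: "monomial \<one>\<^bsub>K\<^esub> b \<in> E" if "b \<in> B" for b
    unfolding E_def by (rule subsetD[OF R.finite_extension_mem[OF A xs]]) (use that bs xs in auto)
  have "carrier M \<subseteq> {a \<in> carrier M. monomial \<one>\<^bsub>K\<^esub> a \<in> E}"
  proof (rule gen)
    show "\<one>\<^bsub>M\<^esub> \<in> {a \<in> carrier M. monomial \<one>\<^bsub>K\<^esub> a \<in> E}" 
      using subringE(3)[OF E] unfolding R_simps(3) by simp
    fix a b assume "b \<in> B" "a \<in> {a \<in> carrier M. monomial \<one>\<^bsub>K\<^esub> a \<in> E}"
    then show "b \<otimes>\<^bsub>M\<^esub> a \<in> {a \<in> carrier M. monomial \<one>\<^bsub>K\<^esub> a \<in> E}"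
      using BE B subringE(6)[OF E, of "monomial \<one>\<^bsub>K\<^esub> b" "monomial \<one>\<^bsub>K\<^esub> a"] by (auto simp: monomial_mult)
  qed
  then have mE: "monomial c a \<in> E" if "c \<in> carrier K" "a \<in> carrier M" for c a
    using that AE subringE(6)[OF E, of "monomial c \<one>\<^bsub>M\<^esub>" "monomial \<one>\<^bsub>K\<^esub> a"] by (auto simp: monomial_mult)
  have "f \<in> E" if "f \<in> carrier R" for f
    using that by (induction rule: monomial_induct) (auto intro: mE subringE(2,7)[OF E])
  then have "E = carrier R" using subringE(1)[OF E] by blast
  then show thesis using that xs unfolding E_def by blast
qed

end

section \<open>The monoid of tableaux\<close>

definition content :: "tableau \<Rightarrow> nat \<Rightarrow> nat multiset" where
  "content T i = mset (tab_row T i)"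

text \<open>
  The Gelfand-Tsetlin inequalities; for large $y$ they say that the row lengths weakly decrease.
\<close>
definition interlacing :: "(nat \<Rightarrow> nat multiset) \<Rightarrow> bool" where
  "interlacing F \<longleftrightarrow> (\<forall>i y. size {#x \<in># F (Suc i). x \<le> y#} \<le> size {#x \<in># F i. x < y#})"

lemma less_length_filter_sorted:
  assumes "sorted r" "\<And>x y. x \<le> y \<Longrightarrow> P y \<Longrightarrow> P x"
  shows "j < length (filter P r) \<longleftrightarrow> j < length r \<and> P (r ! j)"
  using assms(1)
proof (induction r arbitrary: j)
  case (Cons x xs)
  show ?case
  proof (cases "P x")
    case True
    then show ?thesis using Cons by (cases j) auto
  next
    case False
    then have "\<forall>y\<in>set (x # xs). \<not> P y" using Cons.prems assms(2) by auto
    then have "filter P (x # xs) = []" "j < length (x # xs) \<Longrightarrow> \<not> P ((x # xs) ! j)"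
      by (simp add: filter_empty_conv del: filter.simps, blast dest: nth_mem)
    then show ?thesis by auto
  qed
qed simp

text \<open>
  In a sorted row the entries at most $y$ form an initial segment, so both sides compare positions
  with counts. Left to right uses all $y$; from right to left, the entry of $b$ in column $j$ is taken as $y$.
\<close>
lemma column_strict_iff:
  fixes a b :: "nat list"
  assumes "sorted a" "sorted b"
  shows "(\<forall>j < length b. j < length a \<and> a ! j < b ! j)
    \<longleftrightarrow> (\<forall>y. size {#x \<in># mset b. x \<le> y#} \<le> size {#x \<in># mset a. x < y#})"
proof -
  have b: "j < size {#x \<in># mset b. x \<le> y#} \<longleftrightarrow> j < length b \<and> b ! j \<le> y" for j y
    using less_length_filter_sorted[OF assms(2), of "\<lambda>x. x \<le> y" j] by (simp flip: mset_filter)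
  have a: "j < size {#x \<in># mset a. x < y#} \<longleftrightarrow> j < length a \<and> a ! j < y" for j y
    using less_length_filter_sorted[OF assms(1), of "\<lambda>x. x < y" j] by (simp flip: mset_filter)
  show ?thesis
  proof (intro iffI allI impI)
    fix y assume *: "\<forall>j < length b. j < length a \<and> a ! j < b ! j"
    show "size {#x \<in># mset b. x \<le> y#} \<le> size {#x \<in># mset a. x < y#}"
    proof (rule ccontr)
      assume "\<not> ?thesis"
      then have "size {#x \<in># mset a. x < y#} < size {#x \<in># mset b. x \<le> y#}" by simp
      with b have "size {#x \<in># mset a. x < y#} < size {#x \<in># mset a. x < y#}"
        unfolding a using * by (meson less_le_trans)
      then show False by simp
    qed
  next
    fix j assume *: "\<forall>y. size {#x \<in># mset b. x \<le> y#} \<le> size {#x \<in># mset a. x < y#}" "j < length b"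
    have "j < size {#x \<in># mset b. x \<le> b ! j#}" using * b by simp
    also have "\<dots> \<le> size {#x \<in># mset a. x < b ! j#}" using * by blast
    finally show "j < length a \<and> a ! j < b ! j" unfolding a .
  qed
qed

lemma SSYT_iff:
  "T \<in> SSYT n m \<longleftrightarrow> length T \<le> n \<and> (\<forall>r\<in>set T. r \<noteq> [] \<and> sorted r \<and> set r \<subseteq> {1..m})
     \<and> interlacing (content T)"
proof -
  have transp: "transp ((\<ge>) :: nat \<Rightarrow> nat \<Rightarrow> bool)" by (auto intro: transpI)
  have part: "is_partition (shape T) \<longleftrightarrow>
      (\<forall>i. Suc i < length T \<longrightarrow> length (T ! Suc i) \<le> length (T ! i)) \<and> (\<forall>r\<in>set T. r \<noteq> [])"
    by (auto simp: is_partition_def shape_def sorted_wrt_iff_nth_Suc_transp[OF transp])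
  have inter: "(\<forall>i. Suc i < length T \<longrightarrow> length (T ! Suc i) \<le> length (T ! i)) \<and>
      (\<forall>i j. Suc i < length T \<and> j < length (T ! Suc i) \<longrightarrow> T ! i ! j < T ! Suc i ! j)
      \<longleftrightarrow> interlacing (content T)" if sorted: "\<forall>r\<in>set T. sorted r"
  proof -
    have s: "sorted (tab_row T i)" for i using sorted by (simp add: tab_row_def)
    have "interlacing (content T) \<longleftrightarrow> (\<forall>i. \<forall>j < length (tab_row T (Suc i)).
        j < length (tab_row T i) \<and> tab_row T i ! j < tab_row T (Suc i) ! j)"
      unfolding interlacing_def content_def column_strict_iff[OF s s] ..
    also have "\<dots> \<longleftrightarrow> (\<forall>i. Suc i < length T \<longrightarrow> (\<forall>j < length (T ! Suc i).
        j < length (T ! i) \<and> T ! i ! j < T ! Suc i ! j))"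
      by (auto simp: tab_row_def)
    also have "\<dots> \<longleftrightarrow> (\<forall>i. Suc i < length T \<longrightarrow> length (T ! Suc i) \<le> length (T ! i)) \<and>
      (\<forall>i j. Suc i < length T \<and> j < length (T ! Suc i) \<longrightarrow> T ! i ! j < T ! Suc i ! j)"
      by (meson less_le_trans not_le order_refl)
    finally show ?thesis by blast
  qed
  show ?thesis
    unfolding SSYT_def semistandard_def mem_Collect_eq part using inter by fastforce
qed

lemma content_star: "content (tab_star T T') i = content T i + content T' i"
  by (auto simp: content_def tab_row_def tab_star_def)

lemma content_eq_empty_iff:
  assumes "T \<in> SSYT n m"
  shows "content T i = {#} \<longleftrightarrow> length T \<le> i"
  using assms by (auto simp: SSYT_iff content_def tab_row_def)

lemma content_inject:
  assumes T: "T \<in> SSYT n m" and T': "T' \<in> SSYT n m" and eq: "\<And>i. content T i = content T' i"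
  shows "T = T'"
proof (rule nth_equalityI)
  have "length T \<le> i \<longleftrightarrow> length T' \<le> i" for i
    using content_eq_empty_iff[OF T] content_eq_empty_iff[OF T'] eq by metis
  then show len: "length T = length T'" by (meson order_antisym order_refl)
  fix i assume i: "i < length T"
  have "sorted (T ! i)" "sorted (T' ! i)" using T T' i len by (auto simp: SSYT_iff)
  moreover have "mset (T ! i) = mset (T' ! i)"
    using eq[of i] i len by (simp add: content_def tab_row_def)
  ultimately show "T ! i = T' ! i"
    by (metis properties_for_sort sorted_sort_id)
qed

lemma set_content: "T \<in> SSYT n m \<Longrightarrow> set_mset (content T i) \<subseteq> {1..m}"
  by (auto simp: SSYT_iff content_def tab_row_def)

lemma content_beyond: "T \<in> SSYT n m \<Longrightarrow> n \<le> i \<Longrightarrow> content T i = {#}"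
  by (auto simp: SSYT_iff content_def tab_row_def)

lemma interlacing_empty:
  assumes "interlacing F" "F i = {#}" "i \<le> k"
  shows "F k = {#}"
  using assms(3)
proof (induction k rule: dec_induct)
  case (step k)
  have "size {#x \<in># F (Suc k). x \<le> y#} = 0" for y
    using assms(1) step.IH unfolding interlacing_def by (metis filter_empty_mset le_zero_eq size_empty)
  then have "{#x \<in># F (Suc k). x \<le> y#} = {#}" for y by simp
  then have "x \<notin># F (Suc k)" for x by (metis count_empty not_in_iff count_filter_mset order_refl)
  then show ?case by (simp add: multiset_eqI not_in_iff)
qed (use assms in simp)

text \<open>
  The inequalities force all rows after an empty one to be empty, so the nonempty rows form an
  initial segment and can be listed up to the first empty one.
\<close>
lemma tableau_with_content:
  assumes inter: "interlacing F" and beyond: "\<And>i. n \<le> i \<Longrightarrow> F i = {#}"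
    and entries: "\<And>i. set_mset (F i) \<subseteq> {1..m}"
  obtains T where "T \<in> SSYT n m" "content T = F"
proof -
  define k where "k = (LEAST i. F i = {#})"
  have k: "F k = {#}" "k \<le> n"
    unfolding k_def using LeastI[of "\<lambda>i. F i = {#}" n] Least_le[of "\<lambda>i. F i = {#}" n] beyond by auto
  have nonempty: "F i \<noteq> {#}" if "i < k" for i
    using that not_less_Least unfolding k_def by blast
  define T where "T = map (\<lambda>i. sorted_list_of_multiset (F i)) [0..<k]"
  have content: "content T = F"
  proof
    fix i
    show "content T i = F i"
      using interlacing_empty[OF inter k(1), of i] by (auto simp: content_def tab_row_def T_def)
  qed
  have "sorted_list_of_multiset (F i) \<noteq> []" if "i < k" for i
    using nonempty[OF that] by (metis mset.simps(1) mset_sorted_list_of_multiset)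
  then have "T \<in> SSYT n m"
    unfolding SSYT_iff content using inter k entries by (auto simp: T_def)
  then show thesis using that content by blast
qed

lemma star_closed:
  assumes T: "T \<in> SSYT n m" and T': "T' \<in> SSYT n m"
  shows "tab_star T T' \<in> SSYT n m"
  unfolding SSYT_iff
proof (intro conjI ballI)
  show "length (tab_star T T') \<le> n" using T T' by (auto simp: tab_star_def SSYT_iff)
  show "interlacing (content (tab_star T T'))"
    using T T' by (auto simp: SSYT_iff interlacing_def content_star intro!: add_mono)
  fix r assume "r \<in> set (tab_star T T')"
  then obtain i where i: "i < max (length T) (length T')" "r = sort (tab_row T i @ tab_row T' i)"
    by (auto simp: tab_star_def)
  have "tab_row T i \<noteq> [] \<or> tab_row T' i \<noteq> []"
    using T T' i by (auto simp: SSYT_iff tab_row_def)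
  then show "r \<noteq> []" unfolding i(2) by (metis append_is_Nil_conv length_0_conv length_sort)
  show "sorted r" unfolding i(2) by simp
  have "set (tab_row T i) \<subseteq> {1..m}" "set (tab_row T' i) \<subseteq> {1..m}"
    using T T' by (auto simp: SSYT_iff tab_row_def)
  then show "set r \<subseteq> {1..m}" unfolding i(2) by simp
qed

lemma tableaux_comm_monoid: "comm_monoid (tableaux_monoid n m)"
proof (rule comm_monoidI)
  have one: "[] \<in> SSYT n m"
    by (simp add: SSYT_iff interlacing_def content_def tab_row_def)
  then show "\<one>\<^bsub>tableaux_monoid n m\<^esub> \<in> carrier (tableaux_monoid n m)"
    by (simp add: tableaux_monoid_def)
  fix x y z assume "x \<in> carrier (tableaux_monoid n m)" "y \<in> carrier (tableaux_monoid n m)"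
    "z \<in> carrier (tableaux_monoid n m)"
  then have xyz: "x \<in> SSYT n m" "y \<in> SSYT n m" "z \<in> SSYT n m" by (simp_all add: tableaux_monoid_def)
  show "x \<otimes>\<^bsub>tableaux_monoid n m\<^esub> y \<in> carrier (tableaux_monoid n m)"
    using star_closed xyz by (simp add: tableaux_monoid_def)
  have "tab_star (tab_star x y) z = tab_star x (tab_star y z)"
    by (rule content_inject[of _ n m]) (use xyz in \<open>auto simp: content_star intro!: star_closed\<close>)
  then show "x \<otimes>\<^bsub>tableaux_monoid n m\<^esub> y \<otimes>\<^bsub>tableaux_monoid n m\<^esub> z
      = x \<otimes>\<^bsub>tableaux_monoid n m\<^esub> (y \<otimes>\<^bsub>tableaux_monoid n m\<^esub> z)"
    by (simp add: tableaux_monoid_def)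
  have "tab_star x y = tab_star y x"
    by (rule content_inject[of _ n m]) (use xyz in \<open>auto simp: content_star intro!: star_closed\<close>)
  then show "x \<otimes>\<^bsub>tableaux_monoid n m\<^esub> y = y \<otimes>\<^bsub>tableaux_monoid n m\<^esub> x"
    by (simp add: tableaux_monoid_def)
  have "content [] i = {#}" for i by (simp add: content_def tab_row_def)
  then have "tab_star [] x = x"
    by (intro content_inject[of _ n m]) (use xyz one in \<open>auto simp: content_star intro!: star_closed\<close>)
  then show "\<one>\<^bsub>tableaux_monoid n m\<^esub> \<otimes>\<^bsub>tableaux_monoid n m\<^esub> x = x"
    by (simp add: tableaux_monoid_def)
qed

text \<open>
  The slack of one inequality; on semistandard tableaux the subtraction is never truncated.
\<close>
definition gap :: "nat \<Rightarrow> nat \<Rightarrow> tableau \<Rightarrow> nat" where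
  "gap i y T = size {#x \<in># content T i. x < y#} - size {#x \<in># content T (Suc i). x \<le> y#}"

text \<open>
  Entries are at most $m$, so the slack for any $y > m$ equals the slack for $y = m + 1$, and
  the slacks for $y \le m + 1$ suffice.
\<close>
definition coordinates :: "nat \<Rightarrow> nat \<Rightarrow> (tableau \<Rightarrow> nat) list" where
  "coordinates n m = map (\<lambda>(i, j) T. count (content T i) j) (List.product [0..<n] [0..<m + 1])
     @ map (\<lambda>(i, y). gap i y) (List.product [0..<n] [0..<m + 2])"

lemma set_coordinates:
  "set (coordinates n m) = {\<lambda>T. count (content T i) j | i j. i < n \<and> j \<le> m}
     \<union> {gap i y | i y. i < n \<and> y \<le> Suc m}"
  unfolding coordinates_def set_append set_map set_product set_upt
  by (intro arg_cong2[of _ _ _ _ "(\<union>)"]; force simp: less_Suc_eq_le)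

text \<open>
  For divisibility the candidate quotient is the row-wise difference of multisets. Its entries exist
  by the count coordinates, and it interlaces because the slacks of $S$ do not exceed those of $T$.
\<close>
lemma tableaux_saturated: "saturated_monoid (tableaux_monoid n m) (coordinates n m)"
proof (rule saturated_monoid.intro[OF tableaux_comm_monoid], rule saturated_monoid_axioms.intro)
  have gap: "size {#x \<in># content T (Suc i). x \<le> y#} + gap i y T = size {#x \<in># content T i. x < y#}"
    if "T \<in> SSYT n m" for T i y
    using that by (simp add: SSYT_iff interlacing_def gap_def)
  fix S T assume "S \<in> carrier (tableaux_monoid n m)" "T \<in> carrier (tableaux_monoid n m)"
  then have ST: "S \<in> SSYT n m" "T \<in> SSYT n m" by (simp_all add: tableaux_monoid_def)
  have count0: "count (content T' i) j = 0" if "T' \<in> SSYT n m" "\<not> (i < n \<and> j \<le> m)" for T' i j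
  proof (cases "i < n")
    case True
    then have "j \<notin># content T' i" using set_content[OF that(1), of i] that(2) by auto
    then show ?thesis by (simp add: not_in_iff)
  next
    case False
    then show ?thesis using content_beyond[OF that(1)] by simp
  qed
  show "u (S \<otimes>\<^bsub>tableaux_monoid n m\<^esub> T) = u S + u T" if "u \<in> set (coordinates n m)" for u
  proof -
    have "gap i y (tab_star S T) = gap i y S + gap i y T" for i y
      using gap[OF ST(1), of y i] gap[OF ST(2), of y i] gap[OF star_closed[OF ST], of y i]
      by (simp add: content_star)
    then show ?thesis using that by (auto simp: set_coordinates tableaux_monoid_def content_star)
  qed
  show "S = T" if eq: "\<And>u. u \<in> set (coordinates n m) \<Longrightarrow> u S = u T"
  proof (rule content_inject[OF ST], rule multiset_eqI)
    fix i j
    show "count (content S i) j = count (content T i) j"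
    proof (cases "i < n \<and> j \<le> m")
      case True
      then have "(\<lambda>T. count (content T i) j) \<in> set (coordinates n m)" by (auto simp: set_coordinates)
      from eq[OF this] show ?thesis .
    next
      case False
      then show ?thesis using count0 ST by simp
    qed
  qed
  show "\<exists>D\<in>carrier (tableaux_monoid n m). T = S \<otimes>\<^bsub>tableaux_monoid n m\<^esub> D"
    if le: "\<And>u. u \<in> set (coordinates n m) \<Longrightarrow> u S \<le> u T"
  proof -
    have sub: "content S i \<subseteq># content T i" for i
    proof (rule mset_subset_eqI)
      fix j
      show "count (content S i) j \<le> count (content T i) j"
      proof (cases "i < n \<and> j \<le> m")
        case True
        then have "(\<lambda>T. count (content T i) j) \<in> set (coordinates n m)" by (auto simp: set_coordinates)
        from le[OF this] show ?thesis .
      next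
        case False
        then show ?thesis using count0 ST by simp
      qed
    qed
    have gap_le: "gap i y S \<le> gap i y T" for i y
    proof (cases "i < n")
      case True
      \<comment> \<open>Entries are at most $m$, so thresholds above $m + 1$ give nothing new.\<close>
      have min: "gap i y T' = gap i (min y (Suc m)) T'" if T': "T' \<in> SSYT n m" for T'
      proof -
        have "{#x \<in># content T' i. x < y#} = {#x \<in># content T' i. x < min y (Suc m)#}"
          "{#x \<in># content T' (Suc i). x \<le> y#} = {#x \<in># content T' (Suc i). x \<le> min y (Suc m)#}"
          using set_content[OF T', of i] set_content[OF T', of "Suc i"]
          by (auto intro!: filter_mset_cong)
        then show ?thesis by (simp add: gap_def)
      qed
      have "gap i (min y (Suc m)) \<in> set (coordinates n m)"
        unfolding set_coordinates using True by (blast intro: min.cobounded2)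
      from le[OF this] show ?thesis using min ST by metis
    next
      case False
      then show ?thesis using content_beyond[OF ST(1), of i] by (simp add: gap_def)
    qed
    define F where "F i = content T i - content S i" for i
    have FS: "content T i = content S i + F i" for i using sub by (simp add: F_def)
    have "interlacing F"
      unfolding interlacing_def
    proof (intro allI)
      fix i y
      show "size {#x \<in># F (Suc i). x \<le> y#} \<le> size {#x \<in># F i. x < y#}"
        using gap[OF ST(1), of y i] gap[OF ST(2), of y i] gap_le[of i y] FS[of i] FS[of "Suc i"] by simp
    qed
    moreover have "F i = {#}" if "n \<le> i" for i
      using content_beyond[OF ST(2) that] by (simp add: F_def)
    moreover have "set_mset (F i) \<subseteq> {1..m}" for i
      using set_content[OF ST(2), of i] FS[of i] by auto
    ultimately obtain D where D: "D \<in> SSYT n m" "content D = F"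
      using tableau_with_content by blast
    have "T = tab_star S D"
      by (rule content_inject[OF ST(2) star_closed[OF ST(1) D(1)]]) (simp add: content_star D FS)
    then show ?thesis using D by (auto simp: tableaux_monoid_def)
  qed
qed

lemma (in domain) domain_imp_reduced: "reduced_ring R"
  unfolding reduced_ring_def using pow_nonzero ring_axioms by blast

theorem proposition2p10:
  fixes K :: "('k, 'x) ring_scheme" and n m :: nat
  assumes "algebraically_closed K" and "char_zero K"
    and "0 < n" and "n \<le> m"
  shows "domain (tableaux_algebra K n m) \<and>
         noetherian_ring (tableaux_algebra K n m) \<and>
         reduced_ring (tableaux_algebra K n m) \<and>
         jacobson_ring (tableaux_algebra K n m)"
proof -
  interpret K: algebraically_closed K by fact
  interpret A: saturated_monoid_algebra K "tableaux_monoid n m" "coordinates n m"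
    by (intro saturated_monoid_algebra.intro K.field_axioms tableaux_saturated)
  obtain xs where xs: "set xs \<subseteq> carrier A.R"
    "ring.finite_extension A.R ((\<lambda>c. A.monomial c \<one>\<^bsub>tableaux_monoid n m\<^esub>) ` carrier K) xs = carrier A.R"
    using A.monoid_algebra_finitely_generated .
  have "jacobson_ring A.R"
    using finitely_generated_algebra_jacobson[OF A.monoid_algebra_cring assms(1)
      K.char_zero_imp_infinite[OF assms(2)] A.const_ring_hom xs] .
  then show ?thesis
    unfolding tableaux_algebra_def
    using A.monoid_algebra_domain A.monoid_algebra_noetherian domain.domain_imp_reduced by blast
qed

end
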